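(* Let $g, h \in \mathrm{SS}(\mathbb{R})$ be strongly symmetric homeomorphisms of $\mathbb R$ and suppose that $h^{-1}$ is uniformly continuous on $\mathbb{R}$. Then $g \circ h^{-1} \in \mathrm{SS}(\mathbb{R})$.
   Context: $|\cdot|$ denotes Lebesgue measure on $\mathbb R$. A weight is a locally integrable non-negative measurable function $\omega$ on $\mathbb R$. It is an $A_\infty$-weight if there are constants $C,\alpha>0$ such that $\frac{\int_E\omega\,dx}{\int_I\omega\,dx}\le C\left(\frac{|E|}{|I|}\right)^{\alpha}$ for every bounded closed interval $I\subset\mathbb R$ and every measurable $E\subset I$. A locally integrable function $u$ on $\mathbb R$ is in $\mathrm{BMO}(\mathbb R)$ if $\sup_I \frac1{|I|}\int_I|u-u_I|\,dx<\infty$ (supremum over bounded intervals $I$, with $u_I$ the mean of $u$ over $I$); $u\in\mathrm{BMO}(\mathbb R)$ is in $\mathrm{VMO}(\mathbb R)$ if in addition $\frac1{|I|}\int_I|u-u_I|\,dx\to0$ as $|I|\to0$ (uniformly in $I$). $\mathrm{SS}(\mathbb R)$ is the set of increasing homeomorphisms $h$ of $\mathbb R$ onto itself such that $h$ is locally absolutely continuous, $h'$ is an $A_\infty$-weight, and $\log h'\in\mathrm{VMO}(\mathbb R)$. *)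

theory Defs
  imports "HOL-Analysis.Analysis"
begin

definition locally_integrable :: "(real \<Rightarrow> real) \<Rightarrow> bool" where
  "locally_integrable f \<longleftrightarrow>
     f \<in> borel_measurable lebesgue \<and> (\<forall>a b. set_integrable lebesgue {a..b} f)"

(* Functions are only relevant up to null sets here, so non-negativity is required
   almost everywhere: below, weights arise as derivatives of functions that are merely
   differentiable almost everywhere. *)
definition weight :: "(real \<Rightarrow> real) \<Rightarrow> bool" where
  "weight w \<longleftrightarrow> locally_integrable w \<and> (AE x in lebesgue. 0 \<le> w x)"

(* The quotient of integrals presupposes a nonzero denominator; this is stated explicitly,
   since division by 0 yields 0 and would otherwise admit w = 0. *)
definition A_infinity_weight :: "(real \<Rightarrow> real) \<Rightarrow> bool" where
  "A_infinity_weight w \<longleftrightarrow> weight w \<and>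
     (\<exists>C>0. \<exists>\<alpha>>0. \<forall>a b. a < b \<longrightarrow>
        0 < (LINT x:{a..b}|lebesgue. w x) \<and>
        (\<forall>E\<in>sets lebesgue. E \<subseteq> {a..b} \<longrightarrow>
           (LINT x:E|lebesgue. w x) / (LINT x:{a..b}|lebesgue. w x)
             \<le> C * (measure lebesgue E / measure lebesgue {a..b}) powr \<alpha>))"

definition mean :: "(real \<Rightarrow> real) \<Rightarrow> real set \<Rightarrow> real" where
  "mean u I = (LINT x:I|lebesgue. u x) / measure lebesgue I"

definition mean_oscillation :: "(real \<Rightarrow> real) \<Rightarrow> real set \<Rightarrow> real" where
  "mean_oscillation u I = mean (\<lambda>x. \<bar>u x - mean u I\<bar>) I"

(* Endpoints form a null set, so ranging over the closed intervals {a..b} with a < b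
   covers all nondegenerate bounded intervals. *)
definition BMO :: "(real \<Rightarrow> real) set" where
  "BMO = {u. locally_integrable u \<and> bdd_above {mean_oscillation u {a..b} | a b. a < b}}"

definition VMO :: "(real \<Rightarrow> real) set" where
  "VMO = {u \<in> BMO. \<forall>\<epsilon>>0. \<exists>\<delta>>0. \<forall>a b. a < b \<and> b - a < \<delta> \<longrightarrow> mean_oscillation u {a..b} < \<epsilon>}"

definition abs_continuous_on_interval :: "real \<Rightarrow> real \<Rightarrow> (real \<Rightarrow> real) \<Rightarrow> bool" where
  "abs_continuous_on_interval a b f \<longleftrightarrow>
     (\<forall>\<epsilon>>0. \<exists>\<delta>>0. \<forall>(n::nat) s t.
        (\<forall>i<n. a \<le> s i \<and> s i < t i \<and> t i \<le> b) \<and>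
        disjoint_family_on (\<lambda>i. {s i<..<t i}) {..<n} \<and>
        (\<Sum>i<n. t i - s i) < \<delta>
        \<longrightarrow> (\<Sum>i<n. \<bar>f (t i) - f (s i)\<bar>) < \<epsilon>)"

definition locally_abs_continuous :: "(real \<Rightarrow> real) \<Rightarrow> bool" where
  "locally_abs_continuous f \<longleftrightarrow> (\<forall>a b. a < b \<longrightarrow> abs_continuous_on_interval a b f)"

(* An increasing h is differentiable almost everywhere, so the unspecified value of deriv h
   at the remaining points is immaterial. Likewise the convention for ln at nonpositive
   arguments: applied to the sets E = {x \<in> I. deriv h x > 0}, the A_infinity condition
   and the Lebesgue density theorem force deriv h > 0 almost everywhere. *)
definition SS :: "(real \<Rightarrow> real) set" where
  "SS = {h. strict_mono h \<and> homeomorphism UNIV UNIV h (inv h) \<and>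
            locally_abs_continuous h \<and>
            A_infinity_weight (deriv h) \<and>
            (\<lambda>x. ln (deriv h x)) \<in> VMO}"

end

theory Submission
  imports Defs
begin

text \<open>
  Write w = h', p = g' and k = h^{-1}. The image of the measure w dx under h is Lebesgue measure, so
  g \<circ> k has density r = (p / w) \<circ> k and k has density v = (1 / w) \<circ> k.

  The A-infinity condition for w says that w does not charge small sets much. Passing to
  complements, a set F filling at most half of an interval J satisfies v(F) \<le> \<theta> v(J) with
  \<theta> < 1; applying this inside dyadic stopping intervals for the indicator of F and iterating gives
  v(F) \<le> \<theta>^k v(J) whenever |F| \<le> 4^{-k} |J|, which is a power bound for v. The bound for r is the
  composition of the bounds for v and p.

  Since ln r = u \<circ> k with u = ln p - ln w, a change of variables turns the mean oscillation of ln r over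
  J into the w-weighted oscillation of u over k(J). The latter is at most a constant times the
  largest unweighted oscillation N of u on subintervals: off stopping intervals of total length at most
  |k(J)| / \<kappa> the integrand is at most \<kappa>N, and these intervals carry at most half of the w-mass when
  \<kappa> is large, so an a priori bound X improves to 2\<kappa>N + X/2. An a priori bound
  exists after truncating u. This replaces the John--Nirenberg inequality.
  Uniform continuity of k makes k(J) short when J is short.
\<close>

subsection \<open>Lebesgue differentiation on the line\<close>

text \<open>The hypotheses speak of \<open>deriv h\<close>, which is meaningful only almost
  everywhere, while composition with k is safe for Borel functions. So each derivative is replaced
  by a Borel density that is positive everywhere: the Radon--Nikodym density of the Stieltjes
  measure of h, identified with \<open>deriv h\<close> by Lebesgue differentiation. After that, the
  main estimates compare two measures on disjoint stopping intervals.

  The obstacle is that the power bound for w does not invert directly into one for v. It only yields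
  that a set carrying half of the w-mass of an interval fills a fixed share of its length, a
  statement at one scale; the iteration is what produces a power.

  The base 4 comes from dyadic doubling: a stopping interval has F-density above 1/4, its parent
  does not, so its own density is at most 1/2, which is exactly what the one-scale statement
  accepts.

  In the oscillation estimate the stopping height is a multiple of N, so N cancels from the length
  of the stopping set, and \<kappa> can be chosen from the constants of w alone. Truncation supplies
  the finite starting value without which halving X says nothing.\<close>

text \<open>
  Disjoint intervals tagged at bad points form a fine partial division on which the Henstock sum
  exceeds K times their total length; by Vitali they cover almost all bad points.
\<close>
lemma negligible_not_has_derivative_integral_on:
  fixes f F :: "real \<Rightarrow> real"
  assumes int: "f integrable_on {a..b}"
    and F: "\<And>c d. a \<le> c \<Longrightarrow> c \<le> d \<Longrightarrow> d \<le> b \<Longrightarrow> F d - F c = integral {c..d} f"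
    and K: "K > 0"
  shows "negligible {x \<in> {a<..<b}. \<forall>\<delta>>0. \<exists>y. 0 < \<bar>y - x\<bar> \<and> \<bar>y - x\<bar> < \<delta> \<and> K * \<bar>y - x\<bar> < \<bar>F y - F x - f x * (y - x)\<bar>}"
    (is "negligible ?B")
  unfolding negligible_outer
proof (intro allI impI)
  fix \<epsilon> :: real assume "\<epsilon> > 0"
  let ?e = "K * \<epsilon> / 2"
  have "?e > 0" using K \<open>\<epsilon> > 0\<close> by simp
  have int': "f integrable_on cbox a b" using int by (simp add: cbox_interval)
  obtain \<gamma> where g: "gauge \<gamma>" and gs: "\<And>p. \<lbrakk>p tagged_partial_division_of (cbox a b); \<gamma> fine p\<rbrakk> \<Longrightarrow>
             sum (\<lambda>(x,k). norm(measure lborel k *\<^sub>R f x - integral k f)) p < ?e"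
    by (rule Henstock_lemma[OF int' \<open>?e > 0\<close>]) (rule that)
  \<comment> \<open>The segment between a tag x and a bad point y on either side of it, written as a
    ball because the Vitali covering theorem below is about balls. The tag is an endpoint of its
    segment, which a tagged division allows.\<close>
  define seg :: "real \<times> real \<Rightarrow> real set" where "seg p = cball ((fst p + snd p) / 2) (\<bar>snd p - fst p\<bar> / 2)" for p
  have seg: "seg p = cbox (min (fst p) (snd p)) (max (fst p) (snd p))" for p
    unfolding seg_def by (auto simp: cball_eq_atLeastAtMost cbox_interval min_def max_def field_simps)
  define P where "P = {(x,y). x \<in> ?B \<and> x \<noteq> y \<and> K * \<bar>y - x\<bar> < \<bar>F y - F x - f x * (y - x)\<bar>
     \<and> seg (x,y) \<subseteq> \<gamma> x \<and> seg (x,y) \<subseteq> {a<..<b}}"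
  have cov: "\<exists>i. i \<in> P \<and> x \<in> cball ((fst i + snd i)/2) (\<bar>snd i - fst i\<bar> / 2) \<and> \<bar>snd i - fst i\<bar> / 2 < d"
    if x: "x \<in> ?B" and d: "0 < d" for x d
  proof -
    have "x \<in> \<gamma> x \<inter> {a<..<b}" "open (\<gamma> x \<inter> {a<..<b})"
      using g x by (auto simp: gauge_def)
    then obtain r where r: "r > 0" "ball x r \<subseteq> \<gamma> x \<inter> {a<..<b}"
      using openE by blast
    obtain y where y: "0 < \<bar>y - x\<bar>" "\<bar>y - x\<bar> < min r d" "K * \<bar>y - x\<bar> < \<bar>F y - F x - f x * (y - x)\<bar>"
    proof -
      have "min r d > 0" using r d by simp
      with x that show ?thesis by blast
    qed
    have "seg (x,y) \<subseteq> ball x r"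
      using y by (auto simp: seg cbox_interval dist_real_def min_def max_def split: if_splits)
    then have "(x,y) \<in> P" using r y x unfolding P_def by auto
    moreover have "x \<in> seg (x,y)" by (auto simp: seg cbox_interval)
    ultimately show ?thesis using y by (intro exI[of _ "(x,y)"]) (auto simp: seg_def)
  qed
  have pos: "0 < \<bar>snd i - fst i\<bar> / 2" if "i \<in> P" for i
    using that by (auto simp: P_def)
  obtain C where C: "countable C" "C \<subseteq> P"
     "pairwise (\<lambda>i j. disjnt (seg i) (seg j)) C"
     "negligible (?B - (\<Union>i \<in> C. seg i))"
    unfolding seg_def
    by (rule Vitali_covering_theorem_cballs[of P "\<lambda>i. \<bar>snd i - fst i\<bar> / 2" ?B "\<lambda>i. (fst i + snd i)/2", OF pos cov])
      (assumption | rule that)+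
  have fin: "(\<Sum>i\<in>D. \<bar>snd i - fst i\<bar>) \<le> \<epsilon> / 2" if D: "finite D" "D \<subseteq> C" for D
  proof -
    \<comment> \<open>The Henstock sum ranges over a set of tagged pieces. Disjoint segments
      containing their tags give distinct pairs, so no term of the sum over D is lost.\<close>
    have inj: "inj_on (\<lambda>i. (fst i, seg i)) D"
    proof (rule inj_onI)
      fix i j assume ij: "i \<in> D" "j \<in> D" "(fst i, seg i) = (fst j, seg j)"
      then have "fst i \<in> seg i \<inter> seg j" by (auto simp: seg cbox_interval)
      then show "i = j" using ij D C(3) unfolding pairwise_def disjnt_def by blast
    qed
    let ?p = "(\<lambda>i. (fst i, seg i)) ` D"
    have DP: "i \<in> P" if "i \<in> D" for i using that D C by auto
    have "?p tagged_partial_division_of cbox a b"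
      unfolding tagged_partial_division_of_def
    proof (intro conjI allI impI)
      show "finite ?p" using D by auto
    next
      fix x k assume "(x,k) \<in> ?p"
      then obtain i where i: "i \<in> D" "x = fst i" "k = seg i" by auto
      show "x \<in> k" using i by (auto simp: seg cbox_interval)
      show "\<exists>a b. k = cbox a b" using i seg by blast
      have "seg i \<subseteq> {a<..<b}" using DP[OF i(1)] by (cases i) (simp add: P_def)
      then show "k \<subseteq> cbox a b" using i by (auto simp: cbox_interval)
    next
      fix x1 K1 x2 K2 assume h: "(x1, K1) \<in> ?p \<and> (x2, K2) \<in> ?p \<and> (x1, K1) \<noteq> (x2, K2)"
      then obtain i j where "i \<in> D" "j \<in> D" "K1 = seg i" "K2 = seg j" "i \<noteq> j" by auto
      then have "K1 \<inter> K2 = {}" using D C(3) unfolding pairwise_def disjnt_def by blast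
      then show "interior K1 \<inter> interior K2 = {}" using interior_subset by blast
    qed
    moreover have "\<gamma> fine ?p" using DP by (fastforce simp: fine_def P_def)
    ultimately have "(\<Sum>(x,k)\<in>?p. norm(measure lborel k *\<^sub>R f x - integral k f)) < ?e"
      by (rule gs)
    then have lt: "(\<Sum>i\<in>D. norm(measure lborel (seg i) *\<^sub>R f (fst i) - integral (seg i) f)) < ?e"
      by (simp add: sum.reindex[OF inj])
    have "(\<Sum>i\<in>D. K * \<bar>snd i - fst i\<bar>) \<le> (\<Sum>i\<in>D. norm(measure lborel (seg i) *\<^sub>R f (fst i) - integral (seg i) f))"
    proof (rule sum_mono)
      fix i assume i: "i \<in> D"
      obtain x y where xy: "i = (x,y)" by (cases i)
      have p: "x \<noteq> y" "K * \<bar>y - x\<bar> < \<bar>F y - F x - f x * (y - x)\<bar>" "seg (x,y) \<subseteq> {a<..<b}"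
        using DP[OF i] xy by (auto simp: P_def)
      have "x \<in> seg (x,y)" "y \<in> seg (x,y)" by (auto simp: seg cbox_interval)
      then have ab: "x \<in> {a<..<b}" "y \<in> {a<..<b}" using p(3) by auto
      have "norm(measure lborel (seg i) *\<^sub>R f (fst i) - integral (seg i) f) = \<bar>F y - F x - f x * (y - x)\<bar>"
      proof (cases "x < y")
        case True
        then have "seg i = {x..y}" "F y - F x = integral {x..y} f"
          using F[of x y] ab by (auto simp: xy seg cbox_interval)
        then show ?thesis using True xy by (simp add: algebra_simps abs_minus_commute)
      next
        case False
        then have "seg i = {y..x}" "F x - F y = integral {y..x} f"
          using F[of y x] ab by (auto simp: xy seg cbox_interval)
        then show ?thesis using False xy by (simp add: algebra_simps)
      qed
      then show "K * \<bar>snd i - fst i\<bar> \<le> norm(measure lborel (seg i) *\<^sub>R f (fst i) - integral (seg i) f)"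
        using p xy by simp
    qed
    then have "K * (\<Sum>i\<in>D. \<bar>snd i - fst i\<bar>) < K * (\<epsilon> / 2)"
      using lt by (simp add: sum_distrib_left)
    then show ?thesis using K by simp
  qed
  have lm: "seg i \<in> lmeasurable" for i by (simp add: seg)
  have ms: "measure lebesgue (seg i) = \<bar>snd i - fst i\<bar>" for i
    by (auto simp: seg cbox_interval min_def max_def)
  have U: "(\<Union>i\<in>C. seg i) \<in> lmeasurable \<and> measure lebesgue (\<Union>i\<in>C. seg i) \<le> \<epsilon> / 2"
  proof -
    have *: "measure lebesgue (\<Union>i\<in>D. seg i) \<le> \<epsilon> / 2" if "D \<subseteq> C" "finite D" for D
    proof -
      have "measure lebesgue (\<Union>i\<in>D. seg i) \<le> (\<Sum>i\<in>D. measure lebesgue (seg i))"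
        using that lm by (intro measure_UNION_le) auto
      then show ?thesis using fin[OF that(2,1)] ms by simp
    qed
    show ?thesis
      using fmeasurable_UN_bound[OF C(1), of seg lebesgue "\<epsilon>/2"] measure_UN_bound[OF C(1), of seg lebesgue "\<epsilon>/2"] * lm 
      by blast
  qed
  let ?T = "(\<Union>i\<in>C. seg i) \<union> (?B - (\<Union>i \<in> C. seg i))"
  have "?T \<in> lmeasurable" using U C(4)
    by (intro fmeasurable.Un) (auto simp: negligible_iff_measure)
  moreover have "measure lebesgue ?T \<le> \<epsilon> / 2"
    using U C(4) measure_Un_le[of "\<Union>i\<in>C. seg i" lebesgue "?B - (\<Union>i \<in> C. seg i)"]
    by (auto simp: negligible_iff_measure fmeasurableD)
  ultimately show "\<exists>T. ?B \<subseteq> T \<and> T \<in> lmeasurable \<and> measure lebesgue T < \<epsilon>"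
    using \<open>\<epsilon> > 0\<close> by (intro exI[of _ ?T]) auto
qed

text \<open>Where the derivative fails, the linear error exceeds |y - x| / (n + 1) for some n and
  for points y arbitrarily close to x. The exceptional set is therefore a countable union of null
  sets, over these tolerances and over bounded windows.\<close>

lemma AE_has_derivative_integral:
  fixes f F :: "real \<Rightarrow> real"
  assumes int: "\<And>a b. f integrable_on {a..b}"
    and F: "\<And>c d. c \<le> d \<Longrightarrow> F d - F c = integral {c..d} f"
  shows "AE x in lebesgue. (F has_real_derivative f x) (at x)"
proof -
  define B where "B m n = {x \<in> {- real m<..<real m}. \<forall>\<delta>>0. \<exists>y. 0 < \<bar>y - x\<bar> \<and> \<bar>y - x\<bar> < \<delta> \<and> inverse (real (Suc n)) * \<bar>y - x\<bar> < \<bar>F y - F x - f x * (y - x)\<bar>}" for m n :: nat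
  have "negligible (B m n)" for m n
    unfolding B_def by (rule negligible_not_has_derivative_integral_on) (use int F in auto)
  then have "negligible (\<Union>m n. B m n)" by (auto intro!: negligible_countable_Union)
  moreover have "{x. \<not> (F has_real_derivative f x) (at x)} \<subseteq> (\<Union>m n. B m n)"
  proof (rule subsetI, rule ccontr)
    fix x assume x: "x \<in> {x. \<not> (F has_real_derivative f x) (at x)}" "x \<notin> (\<Union>m n. B m n)"
    obtain m :: nat where m: "\<bar>x\<bar> < real m" using reals_Archimedean2 by blast
    have "((\<lambda>y. (F y - F x) / (y - x)) \<longlongrightarrow> f x) (at x)"
      unfolding LIM_def
    proof (intro allI impI)
      fix r :: real assume "r > 0"
      then obtain n where n: "inverse (real (Suc n)) < r" using reals_Archimedean by blast
      have "x \<notin> B m n" using x by auto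
      then obtain \<delta> where d: "\<delta> > 0" "\<And>y. 0 < \<bar>y - x\<bar> \<Longrightarrow> \<bar>y - x\<bar> < \<delta> \<Longrightarrow> \<bar>F y - F x - f x * (y - x)\<bar> \<le> inverse (real (Suc n)) * \<bar>y - x\<bar>"
        using m unfolding B_def by (force simp: not_less)
      show "\<exists>s>0. \<forall>y. y \<noteq> x \<and> dist y x < s \<longrightarrow> dist ((F y - F x) / (y - x)) (f x) < r"
      proof (intro exI conjI allI impI)
        fix y assume y: "y \<noteq> x \<and> dist y x < \<delta>"
        then have "\<bar>F y - F x - f x * (y - x)\<bar> \<le> inverse (real (Suc n)) * \<bar>y - x\<bar>"
          by (intro d) (auto simp: dist_real_def)
        also have "\<dots> < r * \<bar>y - x\<bar>" using n y by simp
        finally have "\<bar>F y - F x - f x * (y - x)\<bar> / \<bar>y - x\<bar> < r" using y by (simp add: divide_less_eq)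
        moreover have "(F y - F x) / (y - x) - f x = (F y - F x - f x * (y - x)) / (y - x)"
          using y by (simp add: field_simps)
        ultimately show "dist ((F y - F x) / (y - x)) (f x) < r"
          by (simp add: dist_real_def abs_divide)
      qed (use d in auto)
    qed
    then show False using x by (simp add: has_field_derivative_iff)
  qed
  ultimately have "{x. \<not> (F has_real_derivative f x) (at x)} \<in> null_sets lebesgue"
    using negligible_iff_null_sets negligible_subset by blast
  then show ?thesis by (rule AE_I') auto
qed

subsection \<open>Calderon--Zygmund stopping intervals\<close>

text \<open>Since x lies between c and d, the linear errors at both ends add up to at most e(d - c),
  so difference quotients over intervals around x also tend to the derivative. Dyadic intervals
  containing x need this form, as x is usually not an endpoint.\<close>

lemma has_derivative_le_straddle:
  fixes G :: "real \<Rightarrow> real"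
  assumes G: "(G has_real_derivative L) (at x)"
    and small: "\<And>\<epsilon>. \<epsilon> > 0 \<Longrightarrow> \<exists>c d. c \<le> x \<and> x \<le> d \<and> c < d \<and> d - c < \<epsilon> \<and> G d - G c \<le> \<kappa> * (d - c)"
  shows "L \<le> \<kappa>"
proof (rule ccontr)
  assume "\<not> L \<le> \<kappa>"
  define e where "e = (L - \<kappa>) / 2"
  have e: "e > 0" "\<kappa> = L - 2 * e" using \<open>\<not> L \<le> \<kappa>\<close> by (auto simp: e_def field_simps)
  have "((\<lambda>y. (G y - G x) / (y - x)) \<longlongrightarrow> L) (at x)"
    using G by (simp add: has_field_derivative_iff)
  then obtain s where s: "s > 0" "\<And>y. y \<noteq> x \<Longrightarrow> dist y x < s \<Longrightarrow> dist ((G y - G x) / (y - x)) L < e"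
    using e unfolding LIM_def by meson
  have bd: "\<bar>G y - G x - L * (y - x)\<bar> \<le> e * \<bar>y - x\<bar>" if "\<bar>y - x\<bar> < s" for y
  proof (cases "y = x")
    case False
    have "\<bar>(G y - G x) / (y - x) - L\<bar> < e" using s(2)[OF False] that by (simp add: dist_real_def)
    moreover have "(G y - G x) / (y - x) - L = (G y - G x - L * (y - x)) / (y - x)"
      using False by (simp add: field_simps)
    ultimately show ?thesis using False by (simp add: abs_divide divide_less_eq)
  qed auto
  obtain c d where cd: "c \<le> x" "x \<le> d" "c < d" "d - c < s" "G d - G c \<le> \<kappa> * (d - c)"
    using small[OF s(1)] by blast
  have "\<bar>G d - G x - L * (d - x)\<bar> \<le> e * (d - x)" "\<bar>G c - G x - L * (c - x)\<bar> \<le> e * (x - c)"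
    using bd[of d] bd[of c] cd by auto
  then have "G d - G c \<ge> L * (d - c) - e * (d - c)" by (simp add: algebra_simps abs_le_iff)
  moreover have "L * (d - c) - e * (d - c) > \<kappa> * (d - c)"
  proof -
    have "(L - e - \<kappa>) * (d - c) > 0" using e cd by simp
    then show ?thesis by (simp add: algebra_simps)
  qed
  ultimately show False using cd by simp
qed

text \<open>Countable additivity carries a comparison of two measures from single stopping intervals
  to their union. With values in \<open>ennreal\<close> there is no summability to check.\<close>

lemma emeasure_UN_le_mult:
  assumes "countable I" "disjoint_family_on X I" "\<And>i. i \<in> I \<Longrightarrow> X i \<in> sets M" "sets N = sets M"
    and le: "\<And>i. i \<in> I \<Longrightarrow> emeasure N (X i) \<le> c * emeasure M (X i)"
  shows "emeasure N (\<Union>i\<in>I. X i) \<le> c * emeasure M (\<Union>i\<in>I. X i)"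
proof -
  have "emeasure N (\<Union>i\<in>I. X i) = (\<integral>\<^sup>+i. emeasure N (X i) \<partial>count_space I)"
    using assms by (intro emeasure_UN_countable) auto
  also have "\<dots> \<le> (\<integral>\<^sup>+i. c * emeasure M (X i) \<partial>count_space I)"
    by (intro nn_integral_mono) (simp add: le)
  also have "\<dots> = c * (\<integral>\<^sup>+i. emeasure M (X i) \<partial>count_space I)"
    by (rule nn_integral_cmult) simp
  also have "(\<integral>\<^sup>+i. emeasure M (X i) \<partial>count_space I) = emeasure M (\<Union>i\<in>I. X i)"
    using assms by (intro emeasure_UN_countable[symmetric]) auto
  finally show ?thesis .
qed

text \<open>Borel measurability and nonnegativity at every point, not just almost everywhere, let
  such a function serve as a density over \<open>lborel\<close> and be composed with continuous
  maps.\<close>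

definition loc_weight :: "(real \<Rightarrow> real) \<Rightarrow> bool" where
  "loc_weight w \<longleftrightarrow> w \<in> borel_measurable borel \<and> (\<forall>x. 0 \<le> w x) \<and> (\<forall>a b. set_integrable lborel {a..b} w)"

definition dens :: "(real \<Rightarrow> real) \<Rightarrow> real measure" where
  "dens w = density lborel (\<lambda>x. ennreal (w x))"

lemma sets_dens [simp, measurable_cong]: "sets (dens w) = sets borel"
  by (simp add: dens_def)

lemma loc_weight_nonneg: "loc_weight w \<Longrightarrow> 0 \<le> w x"
  by (simp add: loc_weight_def)

lemma loc_weight_set_integrable:
  assumes "loc_weight w" "E \<subseteq> {a..b}" "E \<in> sets borel"
  shows "set_integrable lborel E w"
  using assms by (intro set_integrable_subset[of lborel "{a..b}" w E]) (auto simp: loc_weight_def)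

lemma emeasure_dens:
  assumes "loc_weight w" "E \<subseteq> {a..b}" "E \<in> sets borel"
  shows "emeasure (dens w) E = ennreal (LINT x:E|lborel. w x)"
proof -
  have [measurable]: "w \<in> borel_measurable borel" "E \<in> sets borel" using assms by (auto simp: loc_weight_def)
  have "emeasure (dens w) E = (\<integral>\<^sup>+x. ennreal (w x) * indicator E x \<partial>lborel)"
    unfolding dens_def by (rule emeasure_density) auto
  also have "\<dots> = (\<integral>\<^sup>+x. ennreal (indicator E x * w x) \<partial>lborel)"
    by (intro nn_integral_cong) (auto simp: indicator_def)
  also have "\<dots> = ennreal (LINT x|lborel. indicator E x * w x)"
    using loc_weight_set_integrable[OF assms] loc_weight_nonneg[OF assms(1)]
    by (intro nn_integral_eq_integral) (auto simp: set_integrable_def)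
  finally show ?thesis by (simp add: set_lebesgue_integral_def)
qed

lemma measure_dens:
  assumes "loc_weight w" "E \<subseteq> {a..b}" "E \<in> sets borel"
  shows "measure (dens w) E = (LINT x:E|lborel. w x)"
proof -
  have "0 \<le> (LINT x:E|lborel. w x)"
    using loc_weight_nonneg[OF assms(1)] by (auto simp: set_lebesgue_integral_def intro!: integral_nonneg_AE)
  then show ?thesis by (simp add: measure_def emeasure_dens[OF assms])
qed

lemma emeasure_dens_eq_measure:
  assumes "loc_weight w" "E \<subseteq> {a..b}" "E \<in> sets borel"
  shows "emeasure (dens w) E = ennreal (measure (dens w) E)"
  using emeasure_dens[OF assms] measure_dens[OF assms] by simp

lemma AE_dens:
  assumes "w \<in> borel_measurable borel" "AE x in lborel. P x"
  shows "AE x in dens w. P x"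
  using assms unfolding dens_def by (subst AE_density) auto

text \<open>Stopping intervals are half-open so that they are truly disjoint, while averages and
  oscillations refer to closed intervals; this converts between the two.\<close>

lemma emeasure_dens_half_open:
  assumes "w \<in> borel_measurable borel"
  shows "emeasure (dens w) {a..<b} = emeasure (dens w) {a..b}"
proof (rule emeasure_eq_AE)
  have "AE x in lborel. x \<noteq> b" by (rule AE_lborel_singleton)
  then show "AE x in dens w. (x \<in> {a..<b}) = (x \<in> {a..b})"
    by (intro AE_dens assms) (auto elim: eventually_mono)
qed auto

lemma measure_dens_mono:
  assumes "loc_weight w" "E \<subseteq> F" "F \<subseteq> {a..b}" "E \<in> sets borel" "F \<in> sets borel"
  shows "measure (dens w) E \<le> measure (dens w) F"
  using assms by (intro measure_mono_fmeasurable) (auto intro!: fmeasurableI simp: emeasure_dens_eq_measure)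

text \<open>Lebesgue measure is the density measure of the constant 1, so the facts about
  \<open>dens\<close> also serve for lengths.\<close>

lemma loc_weight_1: "loc_weight (\<lambda>_. 1)"
  by (auto simp: loc_weight_def set_integrable_def integrable_indicator_iff emeasure_lborel_Icc_eq)

lemma dens_1: "dens (\<lambda>_. 1) = lborel"
  by (simp add: dens_def density_1)

text \<open>With a primitive G, averages of w over intervals become difference quotients, to which
  differentiation almost everywhere applies.\<close>

lemma loc_weight_primitive:
  assumes w: "loc_weight w"
  obtains G where "\<And>c d. c \<le> d \<Longrightarrow> G d - G c = measure (dens w) {c..d}"
    and "AE x in lborel. (G has_real_derivative w x) (at x)"
proof -
  have int: "w integrable_on {c..d}" for c d
    using set_borel_integral_eq_integral(1)[of "{c..d}" w] w by (auto simp: loc_weight_def)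
  \<comment> \<open>The signed integral from 0: at most one of the two intervals is nondegenerate,
    and the other integral is 0.\<close>
  define G where "G x = integral {0..x} w - integral {x..0} w" for x
  have G: "G d - G c = integral {c..d} w" if "c \<le> d" for c d
  proof -
    have e: "integral {x..y} w = 0" if "y \<le> x" for x y :: real
      using that by (cases "x = y") auto
    consider "0 \<le> c" | "d \<le> 0" | "c \<le> 0" "0 \<le> d" by linarith
    then show ?thesis
    proof cases
      case 1
      then show ?thesis using that Henstock_Kurzweil_Integration.integral_combine[OF _ _ int, of 0 c d] e by (auto simp: G_def)
    next
      case 2
      then show ?thesis using that Henstock_Kurzweil_Integration.integral_combine[OF _ _ int, of c d 0] e by (auto simp: G_def)
    next
      case 3
      then show ?thesis using that Henstock_Kurzweil_Integration.integral_combine[OF _ _ int, of c 0 d] e by (auto simp: G_def)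
    qed
  qed
  have "AE x in lebesgue. (G has_real_derivative w x) (at x)"
    by (rule AE_has_derivative_integral) (use int G in auto)
  moreover have "G d - G c = measure (dens w) {c..d}" if "c \<le> d" for c d
    using G[OF that] w by (simp add: measure_dens[OF w subset_refl] set_borel_integral_eq_integral(2) loc_weight_def)
  ultimately show ?thesis using that[of G] by (simp add: AE_completion_iff)
qed

text \<open>For dyadic indices: integer division by 2^j yields the index of the ancestor j levels
  up.\<close>

lemma nat_floor_divide_two_power:
  fixes y :: real
  assumes "0 \<le> y"
  shows "nat \<lfloor>y\<rfloor> div 2 ^ j = nat \<lfloor>y / 2 ^ j\<rfloor>"
proof -
  have "\<lfloor>y / real_of_int (2 ^ j)\<rfloor> = \<lfloor>y\<rfloor> div 2 ^ j" by (rule floor_divide_real_eq_div) simp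
  then show ?thesis using assms by (simp add: nat_div_distrib nat_power_eq)
qed

text \<open>The selected intervals are the maximal dyadic subintervals on which the average of f
  exceeds \<kappa>, indexed by level and position. Maximality gives disjointness and, through the
  parent, the upper bound. At a point outside all of them every dyadic interval around it has
  average at most \<kappa>, and differentiation bounds f there almost everywhere.\<close>

lemma calderon_zygmund:
  fixes f :: "real \<Rightarrow> real"
  assumes f: "loc_weight f" and ab: "a < b" and lam: "0 < \<kappa>"
    and avg: "measure (dens f) {a..b} \<le> \<kappa> * (b - a)"
  obtains T :: "(nat \<times> nat) set" and l r :: "nat \<times> nat \<Rightarrow> real"
  where "\<And>i. i \<in> T \<Longrightarrow> a \<le> l i \<and> l i < r i \<and> r i \<le> b"
    and "disjoint_family_on (\<lambda>i. {l i..<r i}) T"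
    and "\<And>i. i \<in> T \<Longrightarrow> \<kappa> * (r i - l i) < measure (dens f) {l i..r i}"
    and "\<And>i. i \<in> T \<Longrightarrow> measure (dens f) {l i..r i} \<le> 2 * \<kappa> * (r i - l i)"
    and "AE x in lborel. x \<in> {a..<b} - (\<Union>i\<in>T. {l i..<r i}) \<longrightarrow> f x \<le> \<kappa>"
proof -
  have fm: "f \<in> borel_measurable borel" using f by (simp add: loc_weight_def)
  define pt where "pt n k = a + (b - a) * real k / 2 ^ n" for n k :: nat
  define bad where "bad n k \<longleftrightarrow> \<kappa> * (pt n (Suc k) - pt n k) < measure (dens f) {pt n k..pt n (Suc k)}" for n k
  \<comment> \<open>\<open>k div 2 ^ (n - m)\<close> is the position of the level-m ancestor, so the
    last condition says that no proper ancestor is bad.\<close>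
  define T where "T = {(n,k). k < 2 ^ n \<and> bad n k \<and> (\<forall>m<n. \<not> bad m (k div 2 ^ (n - m)))}"
  define l where "l = (\<lambda>(n,k). pt n k)"
  define r where "r = (\<lambda>(n,k). pt n (Suc k))"
  \<comment> \<open>The position of the level-n interval containing x, unique because the intervals
    are half-open.\<close>
  define ix where "ix n x = nat \<lfloor>2 ^ n * (x - a) / (b - a)\<rfloor>" for n :: nat and x
  have pt_len: "pt n (Suc k) - pt n k = (b - a) / 2 ^ n" for n k
    by (simp add: pt_def field_simps)
  have pt_lt: "pt n k < pt n (Suc k)" for n k using pt_len[of n k] ab by (smt (verit) divide_pos_pos zero_less_power)
  have ix: "x \<in> {pt n k..<pt n (Suc k)} \<longleftrightarrow> ix n x = k" if "a \<le> x" for n k x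
  proof -
    have nn: "0 \<le> 2 ^ n * (x - a) / (b - a)" using ab that by simp
    have "ix n x = k \<longleftrightarrow> \<lfloor>2 ^ n * (x - a) / (b - a)\<rfloor> = int k"
      using nn unfolding ix_def by (metis floor_less_zero int_nat_eq nat_int not_le zero_le_floor)
    also have "\<dots> \<longleftrightarrow> real k \<le> 2 ^ n * (x - a) / (b - a) \<and> 2 ^ n * (x - a) / (b - a) < real k + 1"
      by (simp add: floor_eq_iff)
    also have "\<dots> \<longleftrightarrow> x \<in> {pt n k..<pt n (Suc k)}"
      using ab by (auto simp: pt_def field_simps)
    finally show ?thesis by simp
  qed
  have ix_lt: "ix n x < 2 ^ n" if "a \<le> x" "x < b" for n x
  proof -
    have "2 ^ n * (x - a) / (b - a) < 2 ^ n" using ab that by (simp add: field_simps)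
    then have "\<lfloor>2 ^ n * (x - a) / (b - a)\<rfloor> < 2 ^ n" by (simp add: floor_less_iff)
    then show ?thesis unfolding ix_def by (simp add: nat_less_iff)
  qed
  have ix_div: "ix n x div 2 ^ (n - m) = ix m x" if "a \<le> x" "m \<le> n" for n m x
  proof -
    have "(2::real) ^ n = 2 ^ (n - m) * 2 ^ m" using that by (simp flip: power_add)
    then have "2 ^ n * (x - a) / (b - a) / 2 ^ (n - m) = 2 ^ m * (x - a) / (b - a)" by simp
    then show ?thesis unfolding ix_def using ab that by (subst nat_floor_divide_two_power) auto
  qed
  have pt_in: "a \<le> pt n k" for n k using ab by (simp add: pt_def)
  have pt_b: "pt n (Suc k) \<le> b" if "k < 2 ^ n" for n k
  proof -
    have "real (Suc k) \<le> 2 ^ n" using that by (metis Suc_leI of_nat_le_iff of_nat_numeral of_nat_power)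
    then have "(b - a) * (real (Suc k) / 2 ^ n) \<le> (b - a) * 1" using ab by (intro mult_left_mono) auto
    then show ?thesis by (simp add: pt_def)
  qed
  have sub: "a \<le> l i \<and> l i < r i \<and> r i \<le> b" if "i \<in> T" for i
    using that pt_in pt_b pt_lt by (auto simp: T_def l_def r_def)
  have "i = j" if "i \<in> T" "j \<in> T" "x \<in> {l i..<r i}" "x \<in> {l j..<r j}" for i j x
  proof -
    obtain n k n' k' where ij: "i = (n,k)" "j = (n',k')" by fastforce
    have ax: "a \<le> x" using sub[OF that(1)] that(3) by simp
    have k: "ix n x = k" "ix n' x = k'" using that ix[OF ax] by (auto simp: ij l_def r_def)
    have "\<not> n < n'" "\<not> n' < n"
      using that ix_div[OF ax, of n n'] ix_div[OF ax, of n' n] k by (auto simp: ij T_def)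
    then show ?thesis using k ij by simp
  qed
  then have disj: "disjoint_family_on (\<lambda>i. {l i..<r i}) T"
    unfolding disjoint_family_on_def by blast
  have lower: "\<kappa> * (r i - l i) < measure (dens f) {l i..r i}" if "i \<in> T" for i
    using that by (auto simp: T_def l_def r_def bad_def)
  have upper: "measure (dens f) {l i..r i} \<le> 2 * \<kappa> * (r i - l i)" if "i \<in> T" for i
  proof -
    obtain n k where i: "i = (n,k)" by fastforce
    have nk: "k < 2 ^ n" "bad n k" "\<And>m. m < n \<Longrightarrow> \<not> bad m (k div 2 ^ (n - m))" using that by (auto simp: T_def i)
    \<comment> \<open>The whole interval is not bad by the assumption on its average. Hence a
      selected interval has a parent, which is not bad and twice as long; this is the factor
      2.\<close>
    have "n \<noteq> 0"
    proof
      assume "n = 0"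
      then have "bad 0 0" using nk by auto
      then show False using avg by (simp add: bad_def pt_def)
    qed
    then obtain m where m: "n = Suc m" by (cases n) auto
    have nb: "\<not> bad m (k div 2)" using nk(3)[of m] by (simp add: m)
    have "pt m (k div 2) \<le> pt n k" "pt n (Suc k) \<le> pt m (Suc (k div 2))"
    proof -
      have "real (2 * (k div 2)) \<le> real k" "real (Suc k) \<le> real (2 * Suc (k div 2))" by (simp_all only: of_nat_le_iff) auto
      then have s0: "2 * real (k div 2) \<le> real k" and s: "real (Suc k) \<le> 2 * real (Suc (k div 2))" by auto
      then have t: "real (k div 2) / 2 ^ m \<le> real k / 2 ^ n"
        using divide_right_mono[OF s0, of "2 ^ n"] by (simp add: m)
      have u: "real (Suc k) / 2 ^ n \<le> real (Suc (k div 2)) / 2 ^ m"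
        using divide_right_mono[OF s, of "2 ^ n"] by (simp add: m del: of_nat_Suc)
      have nn: "0 \<le> b - a" using ab by simp
      show "pt m (k div 2) \<le> pt n k" "pt n (Suc k) \<le> pt m (Suc (k div 2))"
        using mult_left_mono[OF t nn] mult_left_mono[OF u nn]
        by (simp_all only: pt_def times_divide_eq_right add_le_cancel_left)
    qed
    then have "measure (dens f) {pt n k..pt n (Suc k)} \<le> measure (dens f) {pt m (k div 2)..pt m (Suc (k div 2))}"
      by (intro measure_dens_mono[OF f]) auto
    also have "\<dots> \<le> \<kappa> * (pt m (Suc (k div 2)) - pt m (k div 2))" using nb by (simp add: bad_def)
    also have "\<dots> = 2 * \<kappa> * (pt n (Suc k) - pt n k)" by (simp add: pt_len m)
    finally show ?thesis by (simp add: i l_def r_def)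
  qed
  obtain G where G: "\<And>c d. c \<le> d \<Longrightarrow> G d - G c = measure (dens f) {c..d}"
    and dG: "AE x in lborel. (G has_real_derivative f x) (at x)"
    using loc_weight_primitive[OF f] by blast
  have "f x \<le> \<kappa>" if x: "x \<in> {a..<b} - (\<Union>i\<in>T. {l i..<r i})" and d: "(G has_real_derivative f x) (at x)" for x
  proof (rule has_derivative_le_straddle[OF d])
    have ax: "a \<le> x" "x < b" using x by auto
    \<comment> \<open>If some interval around x were bad, the one of least level would be selected
      and would contain x.\<close>
    have nb: "\<not> bad n (ix n x)" for n
    proof (rule ccontr)
      assume "\<not> \<not> bad n (ix n x)"
      then obtain n0 where n0: "bad n0 (ix n0 x)" "\<And>m. m < n0 \<Longrightarrow> \<not> bad m (ix m x)"
        using exists_least_iff[of "\<lambda>n. bad n (ix n x)"] by blast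
      have "(n0, ix n0 x) \<in> T" using n0 ix_lt[OF ax] ix_div[OF ax(1), of _ n0] by (auto simp: T_def)
      moreover have "x \<in> {l (n0, ix n0 x)..<r (n0, ix n0 x)}"
        using ix[OF ax(1), of n0 "ix n0 x"] by (simp add: l_def r_def)
      ultimately show False using x by blast
    qed
    fix \<epsilon> :: real assume "\<epsilon> > 0"
    obtain n :: nat where n: "(b - a) / \<epsilon> < 2 ^ n" using real_arch_pow[of 2] by auto
    let ?c = "pt n (ix n x)" and ?d = "pt n (Suc (ix n x))"
    have "?d - ?c < \<epsilon>" using n \<open>\<epsilon> > 0\<close> by (simp add: pt_len field_simps)
    moreover have "?c \<le> x" "x \<le> ?d" using ix[OF ax(1), of n "ix n x"] by auto
    moreover have "G ?d - G ?c \<le> \<kappa> * (?d - ?c)" using nb[of n] pt_lt[of n "ix n x"] by (simp add: bad_def G)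
    ultimately show "\<exists>c d. c \<le> x \<and> x \<le> d \<and> c < d \<and> d - c < \<epsilon> \<and> G d - G c \<le> \<kappa> * (d - c)"
      using pt_lt by blast
  qed
  then have "AE x in lborel. x \<in> {a..<b} - (\<Union>i\<in>T. {l i..<r i}) \<longrightarrow> f x \<le> \<kappa>"
    using dG by (auto elim!: eventually_mono)
  with sub disj lower upper that show ?thesis by blast
qed

subsection \<open>Self-improvement of the A-infinity condition\<close>

text \<open>The A-infinity inequality multiplied out and restricted to Borel sets, so that it makes
  sense without a nonzero denominator. Positivity of C and \<alpha> is stated where it is
  used.\<close>

definition A_inf_bound :: "(real \<Rightarrow> real) \<Rightarrow> real \<Rightarrow> real \<Rightarrow> bool" where
  "A_inf_bound w C \<alpha> \<longleftrightarrow> (\<forall>c d F. c < d \<longrightarrow> F \<in> sets borel \<longrightarrow> F \<subseteq> {c..d} \<longrightarrow>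
     measure (dens w) F \<le> C * (measure lborel F / (d - c)) powr \<alpha> * measure (dens w) {c..d})"

lemma A_inf_boundD:
  assumes "A_inf_bound w C \<alpha>" "c < d" "F \<in> sets borel" "F \<subseteq> {c..d}"
  shows "measure (dens w) F \<le> C * (measure lborel F / (d - c)) powr \<alpha> * measure (dens w) {c..d}"
  using assms unfolding A_inf_bound_def by blast

lemma emeasure_lborel_eq_measure:
  fixes E :: "real set"
  assumes "E \<subseteq> {a..b}" "E \<in> sets borel"
  shows "emeasure lborel E = ennreal (measure lborel E)"
  using emeasure_dens_eq_measure[OF loc_weight_1 assms] by (simp add: dens_1)

lemma loc_weight_indicator:
  assumes "F \<in> sets borel"
  shows "loc_weight (indicator F)"
  using assms unfolding loc_weight_def set_integrable_def
  by (auto simp: emeasure_lborel_Icc_eq intro!: integrable_real_mult_indicator integrable_real_indicator)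

text \<open>Averages of the indicator of F are densities of F, so stopping intervals for the
  indicator are the intervals in which F first becomes dense.\<close>

lemma emeasure_dens_indicator:
  assumes "F \<in> sets borel" "E \<in> sets borel"
  shows "emeasure (dens (indicator F)) E = emeasure lborel (F \<inter> E)"
  using assms emeasure_restricted[of F lborel E] by (simp add: dens_def ennreal_indicator)

text \<open>Let G be the union of the stopping intervals of the indicator of F at height 1/4. Their
  density exceeds 1/4, so |G| \<le> 4|F| and the induction hypothesis for k applies to G. Their
  density is at most 1/2, so \<open>half\<close> gives v(F) \<le> \<theta> v(G), because F lies in G
  up to a null set.\<close>

lemma measure_dens_le_power:
  assumes v: "loc_weight v" and \<theta>: "0 \<le> \<theta>"
    and half: "\<And>c d F. c < d \<Longrightarrow> F \<in> sets borel \<Longrightarrow> F \<subseteq> {c..d} \<Longrightarrow> measure lborel F \<le> (d - c) / 2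
      \<Longrightarrow> measure (dens v) F \<le> \<theta> * measure (dens v) {c..d}"
  shows "a < b \<Longrightarrow> F \<in> sets borel \<Longrightarrow> F \<subseteq> {a..b} \<Longrightarrow> measure lborel F \<le> (b - a) / 4 ^ k
      \<Longrightarrow> measure (dens v) F \<le> \<theta> ^ k * measure (dens v) {a..b}"
proof (induction k arbitrary: F)
  case 0
  then show ?case using measure_dens_mono[OF v, of F "{a..b}" a b] by simp
next
  case (Suc k)
  note ab = Suc.prems(1) and F [measurable] = Suc.prems(2) and Fab = Suc.prems(3)
  have vm [measurable]: "v \<in> borel_measurable borel" using v by (simp add: loc_weight_def)
  have meas_ind: "measure (dens (indicator F)) E = measure lborel (F \<inter> E)" if "E \<in> sets borel" for E
    using emeasure_dens_indicator[OF F that] by (simp add: measure_def)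
  have "F \<inter> {a..b} = F" using Fab by auto
  moreover have "(b - a) / 4 ^ Suc k \<le> 1/4 * (b - a)"
  proof -
    have "(4::real) \<le> 4 ^ Suc k" by simp
    then have "(b - a) / 4 ^ Suc k \<le> (b - a) / 4" using ab by (intro divide_left_mono) auto
    then show ?thesis by linarith
  qed
  ultimately have "measure (dens (indicator F)) {a..b} \<le> 1/4 * (b - a)"
    using Suc.prems(4) meas_ind[of "{a..b}"] by (metis atLeastAtMost_borel order_trans)
  then obtain T :: "(nat \<times> nat) set" and l r where
    T: "\<And>i. i \<in> T \<Longrightarrow> a \<le> l i \<and> l i < r i \<and> r i \<le> b"
    and disj: "disjoint_family_on (\<lambda>i. {l i..<r i}) T"
    and low: "\<And>i. i \<in> T \<Longrightarrow> 1/4 * (r i - l i) < measure (dens (indicator F)) {l i..r i}"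
    and up: "\<And>i. i \<in> T \<Longrightarrow> measure (dens (indicator F)) {l i..r i} \<le> 2 * (1/4) * (r i - l i)"
    and off: "AE x in lborel. x \<in> {a..<b} - (\<Union>i\<in>T. {l i..<r i}) \<longrightarrow> indicator F x \<le> (1/4::real)"
    using calderon_zygmund[OF loc_weight_indicator[OF F] ab, of "1/4"] by auto
  define G where "G = (\<Union>i\<in>T. {l i..<r i})"
  have cT: "countable T" by (rule countableI_type)
  have Gb [measurable]: "G \<in> sets borel" unfolding G_def using cT by (intro sets.countable_UN') auto
  have Gab: "G \<subseteq> {a..b}" using T by (fastforce simp: G_def)
  have "emeasure lborel G \<le> 4 * emeasure (dens (indicator F)) G"
    unfolding G_def
  proof (rule emeasure_UN_le_mult[OF cT disj])
    fix i assume i: "i \<in> T"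
    have "emeasure lborel {l i..<r i} = ennreal (r i - l i)" using T[OF i] by simp
    also have "\<dots> \<le> ennreal (4 * measure (dens (indicator F)) {l i..r i})"
      using low[OF i] by (intro ennreal_leI) simp
    also have "\<dots> = 4 * emeasure (dens (indicator F)) {l i..<r i}"
      by (simp add: emeasure_dens_half_open emeasure_dens_eq_measure[OF loc_weight_indicator subset_refl] ennreal_mult)
    finally show "emeasure lborel {l i..<r i} \<le> 4 * emeasure (dens (indicator F)) {l i..<r i}" .
  qed auto
  also have "\<dots> \<le> 4 * emeasure lborel F"
    by (intro mult_left_mono) (auto simp: emeasure_dens_indicator intro!: emeasure_mono)
  finally have "measure lborel G \<le> 4 * measure lborel F"
    using emeasure_lborel_eq_measure[OF Gab] emeasure_lborel_eq_measure[OF Fab] 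
    by (simp add: ennreal_mult'[symmetric] flip: ennreal_numeral)
  also have "\<dots> \<le> (b - a) / 4 ^ k" using Suc.prems(4) by simp
  finally have IH: "measure (dens v) G \<le> \<theta> ^ k * measure (dens v) {a..b}"
    by (rule Suc.IH[OF ab Gb Gab])
  \<comment> \<open>The mass of F inside a set is itself a measure of that set, which puts the
    estimate into the form required for disjoint unions.\<close>
  have "emeasure (dens v) (F \<inter> G) = emeasure (density (dens v) (indicator F)) G"
    by (subst emeasure_restricted) auto
  also have "\<dots> \<le> ennreal \<theta> * emeasure (dens v) G"
    unfolding G_def
  proof (rule emeasure_UN_le_mult[OF cT disj])
    fix i assume i: "i \<in> T"
    have "emeasure (density (dens v) (indicator F)) {l i..<r i} = emeasure (dens v) (F \<inter> {l i..<r i})"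
      by (subst emeasure_restricted) auto
    also have "\<dots> = ennreal (measure (dens v) (F \<inter> {l i..<r i}))"
      by (rule emeasure_dens_eq_measure[OF v, of _ "l i" "r i"]) auto
    also have "\<dots> \<le> ennreal (\<theta> * measure (dens v) {l i..r i})"
    proof (intro ennreal_leI half)
      have "measure lborel (F \<inter> {l i..<r i}) \<le> measure lborel (F \<inter> {l i..r i})"
        using measure_dens_mono[OF loc_weight_1, of "F \<inter> {l i..<r i}" "F \<inter> {l i..r i}" "l i" "r i"]
        by (force simp: dens_1)
      then show "measure lborel (F \<inter> {l i..<r i}) \<le> (r i - l i) / 2"
        using up[OF i] meas_ind[of "{l i..r i}"] by simp
    qed (use T[OF i] in auto)
    also have "\<dots> = ennreal \<theta> * emeasure (dens v) {l i..<r i}"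
      using \<theta> by (simp add: emeasure_dens_half_open emeasure_dens_eq_measure[OF v subset_refl] ennreal_mult)
    finally show "emeasure (density (dens v) (indicator F)) {l i..<r i} \<le> ennreal \<theta> * emeasure (dens v) {l i..<r i}" .
  qed auto
  \<comment> \<open>Off G the indicator is at most 1/4 almost everywhere, hence 0. The endpoint b,
    absent from the half-open intervals, is a null set.\<close>
  also have "emeasure (dens v) (F \<inter> G) = emeasure (dens v) F"
  proof (rule emeasure_eq_AE)
    have "AE x in lborel. x \<noteq> b" by (rule AE_lborel_singleton)
    with off have "AE x in lborel. (x \<in> F \<inter> G) = (x \<in> F)"
      by eventually_elim (use Fab in \<open>auto simp: G_def indicator_def split: if_splits\<close>)
    then show "AE x in dens v. (x \<in> F \<inter> G) = (x \<in> F)" by (rule AE_dens[OF vm])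
  qed auto
  finally have "measure (dens v) F \<le> \<theta> * measure (dens v) G"
    using \<theta> by (simp add: emeasure_dens_eq_measure[OF v Fab F] emeasure_dens_eq_measure[OF v Gab Gb] ennreal_mult'[symmetric])
  also have "\<dots> \<le> \<theta> * (\<theta> ^ k * measure (dens v) {a..b})"
    using IH \<theta> by (rule mult_left_mono)
  finally show ?case by simp
qed

text \<open>If F fills the share t of the interval, the largest k with 4^k t \<le> 1 is the integer
  part of log_4(1/t). Rounding down costs one factor 1/\<theta>, and \<theta>^(log_4(1/t)) =
  t^(log_4(1/\<theta>)) turns the rest into a power of t.\<close>

lemma A_inf_bound_if_half:
  assumes v: "loc_weight v" and \<theta>: "0 < \<theta>" "\<theta> < 1"
    and half: "\<And>c d F. c < d \<Longrightarrow> F \<in> sets borel \<Longrightarrow> F \<subseteq> {c..d} \<Longrightarrow> measure lborel F \<le> (d - c) / 2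
      \<Longrightarrow> measure (dens v) F \<le> \<theta> * measure (dens v) {c..d}"
  shows "A_inf_bound v (1 / \<theta>) (log 4 (1 / \<theta>))"
  unfolding A_inf_bound_def
proof (intro allI impI)
  fix c d :: real and F assume cd: "c < d" and F: "F \<in> sets borel" "F \<subseteq> {c..d}"
  define t where "t = measure lborel F / (d - c)"
  have le1: "measure lborel F \<le> d - c"
    using measure_dens_mono[OF loc_weight_1 F(2) order_refl F(1)] cd by (simp add: dens_1)
  have t: "0 \<le> t" "t \<le> 1" using cd le1 by (auto simp: t_def)
  have pw: "measure (dens v) F \<le> \<theta> ^ k * measure (dens v) {c..d}" if "4 ^ k * t \<le> 1" for k
    using that cd by (intro measure_dens_le_power[OF v _ half] F) (use \<theta> in \<open>auto simp: t_def field_simps\<close>)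
  show "measure (dens v) F \<le> 1 / \<theta> * (measure lborel F / (d - c)) powr log 4 (1 / \<theta>) * measure (dens v) {c..d}"
  \<comment> \<open>For a null set every k is admissible, so the mass vanishes in the limit; the
    right-hand side is 0 because \<open>0 powr x\<close> is 0.\<close>
  proof (cases "t = 0")
    case True
    have "(\<lambda>k. \<theta> ^ k * measure (dens v) {c..d}) \<longlonglongrightarrow> 0 * measure (dens v) {c..d}"
      using \<theta> by (intro tendsto_mult LIMSEQ_realpow_zero) auto
    then have "measure (dens v) F \<le> 0 * measure (dens v) {c..d}"
      by (rule LIMSEQ_le_const) (use True in \<open>auto intro!: pw\<close>)
    then show ?thesis using True by (simp add: t_def[symmetric])
  next
    case False
    with t have t0: "0 < t" by simp
    define k where "k = nat \<lfloor>log 4 (1 / t)\<rfloor>"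
    have lg: "0 \<le> log 4 (1 / t)" using t0 t by (simp add: zero_le_log_cancel_iff)
    have k: "real k \<le> log 4 (1 / t)" "log 4 (1 / t) < real k + 1" using lg by (auto simp: k_def)
    have "4 ^ k = 4 powr real k" by (simp add: powr_realpow)
    also have "\<dots> \<le> 4 powr log 4 (1 / t)" using k by (intro powr_mono) auto
    also have "\<dots> = 1 / t" using t0 by simp
    finally have "4 ^ k * t \<le> 1" using t0 by (simp add: field_simps)
    then have "measure (dens v) F \<le> \<theta> ^ k * measure (dens v) {c..d}" by (rule pw)
    also have "\<theta> ^ k \<le> 1 / \<theta> * t powr log 4 (1 / \<theta>)"
    proof -
      have "\<theta> ^ k = \<theta> powr real k" using \<theta> by (simp add: powr_realpow)
      also have "\<dots> \<le> \<theta> powr (log 4 (1 / t) - 1)" using k \<theta> by (intro powr_mono') auto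
      also have "\<dots> = 1 / \<theta> * \<theta> powr log 4 (1 / t)" using \<theta> by (simp add: powr_diff)
      also have "\<theta> powr log 4 (1 / t) = t powr log 4 (1 / \<theta>)"
        using \<theta> t0 by (simp add: powr_def log_def ln_div)
      finally show ?thesis .
    qed
    finally show ?thesis by (simp add: t_def mult_right_mono)
  qed
qed

subsection \<open>Weighted mean oscillation\<close>

lemma set_integrable_const_Icc: "set_integrable lebesgue {c..d::real} (\<lambda>_. k::real)"
proof -
  have "integrable lebesgue (indicator {c..d} :: real \<Rightarrow> real)"
    by (rule integrable_real_indicator) (auto simp: emeasure_lborel_Icc_eq)
  then show ?thesis unfolding set_integrable_def by simp
qed

lemma set_integral_const_Icc: "(c::real) \<le> d \<Longrightarrow> (LINT x:{c..d}|lebesgue. k::real) = k * (d - c)"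
  by (simp add: set_lebesgue_integral_def)

lemma set_integrable_abs_diff:
  assumes "set_integrable lebesgue {c..d::real} (u :: real \<Rightarrow> real)"
  shows "set_integrable lebesgue {c..d} (\<lambda>x. \<bar>u x - k\<bar>)"
  using set_integral_diff(1)[OF assms set_integrable_const_Icc] by (rule set_integrable_abs)

lemma mean_mono:
  assumes "set_integrable lebesgue {c..d} u" "set_integrable lebesgue {c..d} v"
    and "\<And>x. x \<in> {c..d} \<Longrightarrow> u x \<le> v x"
  shows "mean u {c..d} \<le> mean v {c..d}"
  unfolding mean_def using assms by (intro divide_right_mono set_integral_mono) auto

lemma mean_add:
  assumes "set_integrable lebesgue {c..d} u" "set_integrable lebesgue {c..d} v"
  shows "mean (\<lambda>x. u x + v x) {c..d} = mean u {c..d} + mean v {c..d}"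
  unfolding mean_def by (simp add: set_integral_add(2)[OF assms] add_divide_distrib)

lemma mean_diff:
  assumes "set_integrable lebesgue {c..d} u" "set_integrable lebesgue {c..d} v"
  shows "mean (\<lambda>x. u x - v x) {c..d} = mean u {c..d} - mean v {c..d}"
  unfolding mean_def by (simp add: set_integral_diff(2)[OF assms] diff_divide_distrib)

lemma mean_const: "c < d \<Longrightarrow> mean (\<lambda>_. k) {c..d} = k"
  unfolding mean_def by (simp add: set_integral_const_Icc)

lemma abs_mean_le:
  assumes "set_integrable lebesgue {c..d} u"
  shows "\<bar>mean u {c..d}\<bar> \<le> mean (\<lambda>x. \<bar>u x\<bar>) {c..d}"
proof -
  have "\<bar>LINT x:{c..d}|lebesgue. u x\<bar> \<le> (LINT x:{c..d}|lebesgue. \<bar>u x\<bar>)"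
    using integral_abs_bound[of lebesgue "\<lambda>x. indicator {c..d} x * u x"]
    by (simp add: set_lebesgue_integral_def abs_mult)
  then show ?thesis by (simp add: mean_def abs_divide divide_right_mono)
qed

lemma abs_mean_diff_le:
  assumes "c < d" "set_integrable lebesgue {c..d} u"
  shows "\<bar>mean u {c..d} - k\<bar> \<le> mean (\<lambda>x. \<bar>u x - k\<bar>) {c..d}"
proof -
  have "mean u {c..d} - k = mean (\<lambda>x. u x - k) {c..d}"
    using mean_diff[OF assms(2) set_integrable_const_Icc, of k] mean_const[OF assms(1)] by simp
  then show ?thesis using abs_mean_le[OF set_integral_diff(1)[OF assms(2) set_integrable_const_Icc]] by simp
qed

text \<open>The mean differs from k by at most the mean of |u - k|, so replacing the mean by any
  other centre costs at most a factor 2.\<close>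

lemma mean_oscillation_le:
  assumes "c < d" "set_integrable lebesgue {c..d} u"
  shows "mean_oscillation u {c..d} \<le> 2 * mean (\<lambda>x. \<bar>u x - k\<bar>) {c..d}"
proof -
  let ?m = "mean u {c..d}"
  have "mean_oscillation u {c..d} \<le> mean (\<lambda>x. \<bar>u x - k\<bar> + \<bar>?m - k\<bar>) {c..d}"
    unfolding mean_oscillation_def
    by (intro mean_mono set_integrable_abs_diff set_integral_add(1) set_integrable_const_Icc assms) auto
  also have "\<dots> = mean (\<lambda>x. \<bar>u x - k\<bar>) {c..d} + \<bar>?m - k\<bar>"
    using assms by (simp add: mean_add set_integrable_abs_diff set_integrable_const_Icc mean_const)
  also have "\<dots> \<le> 2 * mean (\<lambda>x. \<bar>u x - k\<bar>) {c..d}"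
    using abs_mean_diff_le[OF assms, of k] by simp
  finally show ?thesis .
qed

lemma mean_oscillation_diff_le:
  assumes "c < d" "set_integrable lebesgue {c..d} u" "set_integrable lebesgue {c..d} v"
  shows "mean_oscillation (\<lambda>x. u x - v x) {c..d} \<le> mean_oscillation u {c..d} + mean_oscillation v {c..d}"
proof -
  have "mean_oscillation (\<lambda>x. u x - v x) {c..d}
      \<le> mean (\<lambda>x. \<bar>u x - mean u {c..d}\<bar> + \<bar>v x - mean v {c..d}\<bar>) {c..d}"
    unfolding mean_oscillation_def using assms
    by (intro mean_mono set_integrable_abs_diff set_integral_add(1) set_integral_diff(1))
       (auto simp: mean_diff)
  also have "\<dots> = mean_oscillation u {c..d} + mean_oscillation v {c..d}"
    unfolding mean_oscillation_def using assms by (simp add: mean_add set_integrable_abs_diff)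
  finally show ?thesis .
qed

lemma set_integrable_lebesgue_iff:
  fixes u :: "real \<Rightarrow> real"
  assumes "u \<in> borel_measurable borel" "E \<in> sets borel"
  shows "set_integrable lebesgue E u \<longleftrightarrow> set_integrable lborel E u"
  unfolding set_integrable_def using assms by (intro integrable_completion) simp

lemma set_integral_lebesgue:
  fixes u :: "real \<Rightarrow> real"
  assumes "u \<in> borel_measurable borel" "E \<in> sets borel"
  shows "(LINT x:E|lebesgue. u x) = (LINT x:E|lborel. u x)"
  unfolding set_lebesgue_integral_def using assms by (intro integral_completion) simp

lemma loc_weight_abs_diff:
  assumes "u \<in> borel_measurable borel" "\<And>a b. set_integrable lebesgue {a..b} u"
  shows "loc_weight (\<lambda>x. \<bar>u x - k\<bar>)"
  unfolding loc_weight_def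
  using set_integrable_abs_diff[OF assms(2), of _ _ k] assms(1)
  by (auto simp: set_integrable_lebesgue_iff[symmetric])

lemma measure_dens_mean:
  assumes "loc_weight f" "c < d"
  shows "measure (dens f) {c..d} = mean f {c..d} * (d - c)"
  using assms by (simp add: measure_dens[OF assms(1) subset_refl] mean_def set_integral_lebesgue loc_weight_def)

text \<open>With m the mean over [a,b], stop |u - m| at height \<kappa>N. On a stopping interval Q
  the mean over Q is within 2\<kappa>N of m, so the induction hypothesis bounds the weighted
  integral by (X + 2\<kappa>N) w(Q). These intervals carry at most half of the w-mass and contribute
  X/2 + \<kappa>N per unit of mass; the complement contributes another \<kappa>N.\<close>

lemma nn_integral_oscillation_step:
  fixes u w :: "real \<Rightarrow> real"
  assumes w: "loc_weight w" and A: "A_inf_bound w C \<alpha>"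
    and C: "0 < C" "0 < \<alpha>" "1 \<le> \<kappa>" "C * (1 / \<kappa>) powr \<alpha> \<le> 1 / 2"
    and u: "u \<in> borel_measurable borel" "\<And>a b. set_integrable lebesgue {a..b} u"
    and N: "0 < N" and X: "0 \<le> X" and ab: "a < b"
    and osc: "\<And>c d. a \<le> c \<Longrightarrow> c < d \<Longrightarrow> d \<le> b \<Longrightarrow> mean_oscillation u {c..d} \<le> N"
    and IH: "\<And>c d. a \<le> c \<Longrightarrow> c < d \<Longrightarrow> d \<le> b \<Longrightarrow>
      (\<integral>\<^sup>+x\<in>{c..d}. ennreal \<bar>u x - mean u {c..d}\<bar> \<partial>dens w) \<le> ennreal X * emeasure (dens w) {c..d}"
  shows "(\<integral>\<^sup>+x\<in>{a..b}. ennreal \<bar>u x - mean u {a..b}\<bar> \<partial>dens w)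
    \<le> ennreal (2 * \<kappa> * N + X / 2) * emeasure (dens w) {a..b}"
proof -
  have wm [measurable]: "w \<in> borel_measurable borel" using w by (simp add: loc_weight_def)
  note u(1) [measurable]
  define m where "m = mean u {a..b}"
  define f where "f x = \<bar>u x - m\<bar>" for x
  have f: "loc_weight f" unfolding f_def by (rule loc_weight_abs_diff[OF u])
  have fm [measurable]: "f \<in> borel_measurable borel" using f by (simp add: loc_weight_def)
  have "mean f {a..b} \<le> N"
    using osc[OF order_refl ab order_refl] by (simp add: f_def[abs_def] m_def mean_oscillation_def)
  then have fI: "measure (dens f) {a..b} \<le> N * (b - a)"
    using ab by (simp add: measure_dens_mean[OF f ab] mult_right_mono)
  also have "\<dots> \<le> \<kappa> * N * (b - a)" using C(3) N ab by simp
  finally have avg: "measure (dens f) {a..b} \<le> \<kappa> * N * (b - a)" .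
  have kN: "0 < \<kappa> * N" using C N by simp
  \<comment> \<open>Converts f-mass on stopping intervals into length. As f has mass at most N(b -
    a), the total length is at most (b - a)/\<kappa>, independent of N.\<close>
  define q where "q = 1 / (\<kappa> * N)"
  have q: "0 < q" using kN by (simp add: q_def)
  obtain T :: "(nat \<times> nat) set" and l r where
    T: "\<And>i. i \<in> T \<Longrightarrow> a \<le> l i \<and> l i < r i \<and> r i \<le> b"
    and disj: "disjoint_family_on (\<lambda>i. {l i..<r i}) T"
    and low: "\<And>i. i \<in> T \<Longrightarrow> \<kappa> * N * (r i - l i) < measure (dens f) {l i..r i}"
    and up: "\<And>i. i \<in> T \<Longrightarrow> measure (dens f) {l i..r i} \<le> 2 * (\<kappa> * N) * (r i - l i)"
    and off: "AE x in lborel. x \<in> {a..<b} - (\<Union>i\<in>T. {l i..<r i}) \<longrightarrow> f x \<le> \<kappa> * N"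
    using calderon_zygmund[OF f ab kN avg] by blast
  define G where "G = (\<Union>i\<in>T. {l i..<r i})"
  have cT: "countable T" by (rule countableI_type)
  have Gb [measurable]: "G \<in> sets borel" unfolding G_def using cT by (intro sets.countable_UN') auto
  have Gab: "G \<subseteq> {a..b}" using T by (fastforce simp: G_def)
  have "emeasure lborel G \<le> ennreal (q) * emeasure (dens f) G"
    unfolding G_def
  proof (rule emeasure_UN_le_mult[OF cT disj])
    fix i assume i: "i \<in> T"
    have "emeasure lborel {l i..<r i} = ennreal (r i - l i)" using T[OF i] by simp
    also have "\<dots> \<le> ennreal (q * measure (dens f) {l i..r i})"
    proof (intro ennreal_leI)
      have "(r i - l i) * (\<kappa> * N) \<le> measure (dens f) {l i..r i}" using low[OF i] by (simp only: mult.commute less_imp_le)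
      then have "r i - l i \<le> measure (dens f) {l i..r i} / (\<kappa> * N)" by (subst pos_le_divide_eq[OF kN])
      then show "r i - l i \<le> q * measure (dens f) {l i..r i}" by (simp add: q_def)
    qed
    also have "\<dots> = ennreal (q) * emeasure (dens f) {l i..<r i}"
      using q by (simp add: emeasure_dens_half_open emeasure_dens_eq_measure[OF f subset_refl] ennreal_mult)
    finally show "emeasure lborel {l i..<r i} \<le> ennreal (q) * emeasure (dens f) {l i..<r i}" .
  qed auto
  also have "\<dots> \<le> ennreal (q) * emeasure (dens f) {a..b}"
    using Gab by (intro mult_left_mono emeasure_mono) auto
  also have "\<dots> = ennreal (q * measure (dens f) {a..b})"
    using q by (simp add: emeasure_dens_eq_measure[OF f subset_refl] ennreal_mult)
  finally have "measure lborel G \<le> q * measure (dens f) {a..b}"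
    using q by (simp add: emeasure_lborel_eq_measure[OF Gab Gb])
  also have "\<dots> \<le> q * (N * (b - a))" using fI q by (intro mult_left_mono) auto
  also have "\<dots> = (b - a) / \<kappa>" using N C by (simp add: q_def)
  finally have Gk: "measure lborel G / (b - a) \<le> 1 / \<kappa>" using ab by (subst pos_divide_le_eq) auto
  have "measure (dens w) G \<le> C * (measure lborel G / (b - a)) powr \<alpha> * measure (dens w) {a..b}"
    by (rule A_inf_boundD[OF A ab Gb Gab])
  also have "\<dots> \<le> C * (1 / \<kappa>) powr \<alpha> * measure (dens w) {a..b}"
    using C ab Gk by (intro mult_right_mono mult_left_mono powr_mono2) auto
  also have "\<dots> \<le> 1 / 2 * measure (dens w) {a..b}" using C(4) by (intro mult_right_mono) auto
  finally have half: "measure (dens w) G \<le> 1 / 2 * measure (dens w) {a..b}" .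
  \<comment> \<open>Weighted integrals over sets are read as values of a measure, so that the bounds
    on the stopping intervals can be added up.\<close>
  have memo: "(\<integral>\<^sup>+x\<in>E. ennreal (f x) \<partial>dens w) = emeasure (density (dens w) (\<lambda>x. ennreal (f x))) E" if "E \<in> sets borel" for E
    using that by (subst emeasure_density) auto
  have onG: "emeasure (density (dens w) (\<lambda>x. ennreal (f x))) G \<le> ennreal (X + 2 * \<kappa> * N) * emeasure (dens w) G"
    unfolding G_def
  proof (rule emeasure_UN_le_mult[OF cT disj])
    fix i assume i: "i \<in> T"
    let ?Q = "{l i..r i}"
    have lr: "a \<le> l i" "l i < r i" "r i \<le> b" using T[OF i] by auto
    have "\<bar>mean u ?Q - m\<bar> \<le> mean f ?Q"
      unfolding f_def by (rule abs_mean_diff_le[OF lr(2) u(2)])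
    also have "\<dots> \<le> 2 * \<kappa> * N"
      using up[OF i] lr(2) by (simp add: measure_dens_mean[OF f] mult.assoc[symmetric])
    finally have dm: "\<bar>mean u ?Q - m\<bar> \<le> 2 * \<kappa> * N" .
    have "emeasure (density (dens w) (\<lambda>x. ennreal (f x))) {l i..<r i} \<le> emeasure (density (dens w) (\<lambda>x. ennreal (f x))) ?Q"
      by (intro emeasure_mono) auto
    also have "\<dots> = (\<integral>\<^sup>+x\<in>?Q. ennreal (f x) \<partial>dens w)" by (simp add: memo)
    also have "\<dots> \<le> (\<integral>\<^sup>+x. ennreal \<bar>u x - mean u ?Q\<bar> * indicator ?Q x + ennreal (2 * \<kappa> * N) * indicator ?Q x \<partial>dens w)"
    proof (intro nn_integral_mono)
      fix x
      have "f x \<le> \<bar>u x - mean u ?Q\<bar> + 2 * \<kappa> * N" using dm unfolding f_def by linarith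
      then have "ennreal (f x) \<le> ennreal \<bar>u x - mean u ?Q\<bar> + ennreal (2 * \<kappa> * N)"
        using C N by (simp flip: ennreal_plus)
      then show "ennreal (f x) * indicator ?Q x \<le> ennreal \<bar>u x - mean u ?Q\<bar> * indicator ?Q x + ennreal (2 * \<kappa> * N) * indicator ?Q x"
        by (auto simp: indicator_def)
    qed
    also have "\<dots> = (\<integral>\<^sup>+x\<in>?Q. ennreal \<bar>u x - mean u ?Q\<bar> \<partial>dens w) + ennreal (2 * \<kappa> * N) * emeasure (dens w) ?Q"
      by (subst nn_integral_add) (auto simp: nn_integral_cmult_indicator)
    also have "\<dots> \<le> ennreal X * emeasure (dens w) ?Q + ennreal (2 * \<kappa> * N) * emeasure (dens w) ?Q"
      using IH[OF lr] by (rule add_right_mono)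
    also have "\<dots> = ennreal (X + 2 * \<kappa> * N) * emeasure (dens w) {l i..<r i}"
      using X C N by (simp add: emeasure_dens_half_open distrib_right[symmetric])
    finally show "emeasure (density (dens w) (\<lambda>x. ennreal (f x))) {l i..<r i}
      \<le> ennreal (X + 2 * \<kappa> * N) * emeasure (dens w) {l i..<r i}" .
  qed auto
  have offG: "(\<integral>\<^sup>+x\<in>{a..b}-G. ennreal (f x) \<partial>dens w) \<le> ennreal (\<kappa> * N) * emeasure (dens w) {a..b}"
  proof -
    have "AE x in lborel. x \<noteq> b" by (rule AE_lborel_singleton)
    with off have "AE x in lborel. x \<in> {a..b} - G \<longrightarrow> f x \<le> \<kappa> * N"
      by eventually_elim (auto simp: G_def)
    then have "AE x in dens w. x \<in> {a..b} - G \<longrightarrow> f x \<le> \<kappa> * N" by (rule AE_dens[OF wm])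
    then have "(\<integral>\<^sup>+x\<in>{a..b}-G. ennreal (f x) \<partial>dens w) \<le> (\<integral>\<^sup>+x. ennreal (\<kappa> * N) * indicator {a..b} x \<partial>dens w)"
      by (intro nn_integral_mono_AE) (auto elim!: eventually_mono simp: indicator_def intro!: ennreal_leI)
    then show ?thesis by (simp add: nn_integral_cmult_indicator)
  qed
  have "(\<integral>\<^sup>+x\<in>{a..b}. ennreal (f x) \<partial>dens w) = emeasure (density (dens w) (\<lambda>x. ennreal (f x))) (G \<union> ({a..b} - G))"
    using Gab by (simp add: memo Un_absorb1)
  also have "\<dots> = emeasure (density (dens w) (\<lambda>x. ennreal (f x))) G + emeasure (density (dens w) (\<lambda>x. ennreal (f x))) ({a..b} - G)"
    by (rule plus_emeasure[symmetric]) auto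
  also have "\<dots> \<le> ennreal (X + 2 * \<kappa> * N) * emeasure (dens w) G + ennreal (\<kappa> * N) * emeasure (dens w) {a..b}"
    using onG offG by (intro add_mono) (auto simp: memo)
  also have "\<dots> = ennreal ((X + 2 * \<kappa> * N) * measure (dens w) G + \<kappa> * N * measure (dens w) {a..b})"
    using X kN N C by (simp add: emeasure_dens_eq_measure[OF w Gab Gb] emeasure_dens_eq_measure[OF w subset_refl] ennreal_mult ennreal_plus)
  also have "\<dots> \<le> ennreal ((2 * \<kappa> * N + X / 2) * measure (dens w) {a..b})"
  proof (rule ennreal_leI)
    have "(X + 2 * \<kappa> * N) * measure (dens w) G \<le> (X + 2 * \<kappa> * N) * (1 / 2 * measure (dens w) {a..b})"
      using half X kN by (intro mult_left_mono) (auto simp: mult.assoc)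
    then show "(X + 2 * \<kappa> * N) * measure (dens w) G + \<kappa> * N * measure (dens w) {a..b} \<le> (2 * \<kappa> * N + X / 2) * measure (dens w) {a..b}"
      by (simp add: algebra_simps)
  qed
  also have "\<dots> = ennreal (2 * \<kappa> * N + X / 2) * emeasure (dens w) {a..b}"
    using X kN by (simp add: emeasure_dens_eq_measure[OF w subset_refl] ennreal_mult mult.assoc)
  finally show ?thesis by (simp add: f_def m_def)
qed

text \<open>Boundedness of u gives the finite starting value, and the improvement is iterated to its
  fixed point. The induction covers all subintervals at once, because a step for one interval uses
  the previous bound on its stopping intervals.\<close>

lemma nn_integral_oscillation_bounded:
  fixes u w :: "real \<Rightarrow> real"
  assumes w: "loc_weight w" and A: "A_inf_bound w C \<alpha>"
    and C: "0 < C" "0 < \<alpha>" "1 \<le> \<kappa>" "C * (1 / \<kappa>) powr \<alpha> \<le> 1 / 2"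
    and u: "u \<in> borel_measurable borel" "\<And>a b. set_integrable lebesgue {a..b} u"
    and N: "0 < N" and ab: "a < b" and B: "\<And>x. \<bar>u x\<bar> \<le> B"
    and osc: "\<And>c d. a \<le> c \<Longrightarrow> c < d \<Longrightarrow> d \<le> b \<Longrightarrow> mean_oscillation u {c..d} \<le> N"
  shows "(\<integral>\<^sup>+x\<in>{a..b}. ennreal \<bar>u x - mean u {a..b}\<bar> \<partial>dens w)
    \<le> ennreal (4 * \<kappa> * N) * emeasure (dens w) {a..b}"
proof -
  have B0: "0 \<le> B" using B[of 0] by linarith
  have kN: "0 < \<kappa> * N" using C N by simp
  \<comment> \<open>The orbit of X -> 2\<kappa>N + X/2, with fixed point 4\<kappa>N and an initial
    value that dominates the trivial bound 2B.\<close>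
  define X where "X j = 4 * \<kappa> * N + 2 * B / 2 ^ j" for j :: nat
  have X0: "0 \<le> X j" for j using C N B0 by (simp add: X_def)
  have bd: "(\<integral>\<^sup>+x\<in>{c..d}. ennreal \<bar>u x - mean u {c..d}\<bar> \<partial>dens w) \<le> ennreal (X j) * emeasure (dens w) {c..d}"
    if "a \<le> c" "c < d" "d \<le> b" for c d j
    using that
  proof (induction j arbitrary: c d)
    case 0
    have "\<bar>mean u {c..d}\<bar> \<le> mean (\<lambda>x. \<bar>u x\<bar>) {c..d}" by (rule abs_mean_le[OF u(2)])
    also have "\<dots> \<le> mean (\<lambda>_. B) {c..d}"
      by (intro mean_mono set_integrable_abs u set_integrable_const_Icc B)
    finally have m: "\<bar>mean u {c..d}\<bar> \<le> B" using 0 by (simp add: mean_const)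
    have "\<bar>u x - mean u {c..d}\<bar> \<le> X 0" for x
      using B[of x] m kN by (simp add: X_def)
    then have "(\<integral>\<^sup>+x\<in>{c..d}. ennreal \<bar>u x - mean u {c..d}\<bar> \<partial>dens w) \<le> (\<integral>\<^sup>+x\<in>{c..d}. ennreal (X 0) \<partial>dens w)"
      by (intro nn_integral_mono mult_right_mono ennreal_leI) auto
    then show ?case by (simp add: nn_integral_cmult_indicator)
  next
    case (Suc j)
    have "X (Suc j) = 2 * \<kappa> * N + X j / 2" by (simp add: X_def)
    then show ?case
      using nn_integral_oscillation_step[OF w A C u N X0 Suc.prems(2), of j] osc Suc.IH Suc.prems by auto
  qed
  have "(\<lambda>j. 2 * B * (1 / 2) ^ j) \<longlonglongrightarrow> 2 * B * 0"
    by (intro tendsto_mult_left LIMSEQ_power_zero) simp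
  then have "X \<longlonglongrightarrow> 4 * \<kappa> * N + 0"
    unfolding X_def by (intro tendsto_add tendsto_const) (simp add: power_one_over field_simps)
  then have "(\<lambda>j. ennreal (X j * measure (dens w) {a..b})) \<longlonglongrightarrow> ennreal (4 * \<kappa> * N * measure (dens w) {a..b})"
    by (intro tendsto_ennrealI tendsto_mult) auto
  moreover have "(\<integral>\<^sup>+x\<in>{a..b}. ennreal \<bar>u x - mean u {a..b}\<bar> \<partial>dens w) \<le> ennreal (X j * measure (dens w) {a..b})" for j
    using bd[OF order_refl ab order_refl, of j] X0 by (simp add: emeasure_dens_eq_measure[OF w subset_refl] ennreal_mult)
  ultimately have "(\<integral>\<^sup>+x\<in>{a..b}. ennreal \<bar>u x - mean u {a..b}\<bar> \<partial>dens w) \<le> ennreal (4 * \<kappa> * N * measure (dens w) {a..b})"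
    by (intro LIMSEQ_le_const) auto
  moreover have "ennreal (4 * \<kappa> * N * measure (dens w) {a..b}) = ennreal (4 * \<kappa> * N) * ennreal (measure (dens w) {a..b})"
    by (rule ennreal_mult) (use C N in auto)
  ultimately show ?thesis by (simp only: emeasure_dens_eq_measure[OF w subset_refl atLeastAtMost_borel])
qed

text \<open>Truncation is 1-Lipschitz, so centring at the truncated mean bounds the oscillation of
  the truncated function by 2N; this doubles the constant 4\<kappa>N. The heights B then tend to
  infinity: dominated convergence handles the means, Fatou the weighted integrals.\<close>

lemma nn_integral_oscillation_le:
  fixes u w :: "real \<Rightarrow> real"
  assumes w: "loc_weight w" and A: "A_inf_bound w C \<alpha>"
    and C: "0 < C" "0 < \<alpha>" "1 \<le> \<kappa>" "C * (1 / \<kappa>) powr \<alpha> \<le> 1 / 2"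
    and u: "u \<in> borel_measurable borel" "\<And>a b. set_integrable lebesgue {a..b} u"
    and N: "0 < N" and ab: "a < b"
    and osc: "\<And>c d. a \<le> c \<Longrightarrow> c < d \<Longrightarrow> d \<le> b \<Longrightarrow> mean_oscillation u {c..d} \<le> N"
  shows "(\<integral>\<^sup>+x\<in>{a..b}. ennreal \<bar>u x - mean u {a..b}\<bar> \<partial>dens w)
    \<le> ennreal (8 * \<kappa> * N) * emeasure (dens w) {a..b}"
proof -
  note u(1) [measurable]
  define t where "t B y = max (- real B) (min (real B) y)" for B :: nat and y
  have tm [measurable]: "t B \<in> borel_measurable borel" for B unfolding t_def by measurable
  have lip: "\<bar>t B y - t B z\<bar> \<le> \<bar>y - z\<bar>" for B y z by (auto simp: t_def)
  have t0: "\<bar>t B y\<bar> \<le> \<bar>y\<bar>" "\<bar>t B y\<bar> \<le> real B" for B y by (auto simp: t_def)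
  have lim: "(\<lambda>B. t B y) \<longlonglongrightarrow> y" for y
  proof -
    obtain n :: nat where "\<bar>y\<bar> \<le> real n" using real_arch_simple by blast
    then have "eventually (\<lambda>B. t B y = y) sequentially"
      unfolding eventually_sequentially t_def by (intro exI[of _ n]) auto
    then show ?thesis by (rule tendsto_eventually)
  qed
  have tint: "set_integrable lebesgue {c..d} (\<lambda>x. t B (u x))" for c d B
  proof (rule set_integrable_bound[OF u(2)[of c d]])
    show "set_borel_measurable lebesgue {c..d} (\<lambda>x. t B (u x))"
      unfolding set_borel_measurable_def by (rule measurable_completion) simp
  qed (use t0(1) in auto)
  have tosc: "mean_oscillation (\<lambda>x. t B (u x)) {c..d} \<le> 2 * N" if "a \<le> c" "c < d" "d \<le> b" for c d B
  proof -
    have "mean_oscillation (\<lambda>x. t B (u x)) {c..d} \<le> 2 * mean (\<lambda>x. \<bar>t B (u x) - t B (mean u {c..d})\<bar>) {c..d}"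
      by (rule mean_oscillation_le[OF that(2) tint])
    also have "mean (\<lambda>x. \<bar>t B (u x) - t B (mean u {c..d})\<bar>) {c..d} \<le> mean_oscillation u {c..d}"
      unfolding mean_oscillation_def by (intro mean_mono set_integrable_abs_diff tint u lip)
    finally show ?thesis using osc[OF that] by simp
  qed
  have "(\<integral>\<^sup>+x\<in>{a..b}. ennreal \<bar>t B (u x) - mean (\<lambda>x. t B (u x)) {a..b}\<bar> \<partial>dens w)
      \<le> ennreal (4 * \<kappa> * (2 * N)) * emeasure (dens w) {a..b}" for B
    by (rule nn_integral_oscillation_bounded[OF w A C _ tint _ ab t0(2) tosc]) (use N in auto)
  then have le: "(\<integral>\<^sup>+x\<in>{a..b}. ennreal \<bar>t B (u x) - mean (\<lambda>x. t B (u x)) {a..b}\<bar> \<partial>dens w)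
      \<le> ennreal (8 * \<kappa> * N) * emeasure (dens w) {a..b}" for B by (simp add: mult_ac)
  have "(\<lambda>B. LINT x|lebesgue. indicator {a..b} x *\<^sub>R t B (u x)) \<longlonglongrightarrow> (LINT x|lebesgue. indicator {a..b} x *\<^sub>R u x)"
  proof (rule integral_dominated_convergence[where w="\<lambda>x. indicator {a..b} x *\<^sub>R \<bar>u x\<bar>"])
    show "integrable lebesgue (\<lambda>x. indicator {a..b} x *\<^sub>R \<bar>u x\<bar>)"
      using set_integrable_abs[OF u(2)[of a b]] by (simp add: set_integrable_def)
    show "AE x in lebesgue. (\<lambda>B. indicator {a..b} x *\<^sub>R t B (u x)) \<longlonglongrightarrow> indicator {a..b} x *\<^sub>R u x"
      by (intro AE_I2 tendsto_scaleR tendsto_const lim)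
    show "AE x in lebesgue. norm (indicator {a..b} x *\<^sub>R t B (u x)) \<le> indicator {a..b} x *\<^sub>R \<bar>u x\<bar>" for B
      using t0(1) by (intro AE_I2) (auto simp: indicator_def)
  qed (rule measurable_completion, simp)+
  then have mlim: "(\<lambda>B. mean (\<lambda>x. t B (u x)) {a..b}) \<longlonglongrightarrow> mean u {a..b}"
    unfolding mean_def set_lebesgue_integral_def using ab by (intro tendsto_divide tendsto_const) auto
  have "(\<integral>\<^sup>+x\<in>{a..b}. ennreal \<bar>u x - mean u {a..b}\<bar> \<partial>dens w)
     = (\<integral>\<^sup>+x. liminf (\<lambda>B. ennreal \<bar>t B (u x) - mean (\<lambda>x. t B (u x)) {a..b}\<bar> * indicator {a..b} x) \<partial>dens w)"
  proof (intro nn_integral_cong)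
    fix x
    have "(\<lambda>B. \<bar>t B (u x) - mean (\<lambda>x. t B (u x)) {a..b}\<bar>) \<longlonglongrightarrow> \<bar>u x - mean u {a..b}\<bar>"
      by (intro tendsto_rabs tendsto_diff lim mlim)
    then have "(\<lambda>B. ennreal \<bar>t B (u x) - mean (\<lambda>x. t B (u x)) {a..b}\<bar> * indicator {a..b} x) \<longlonglongrightarrow> ennreal \<bar>u x - mean u {a..b}\<bar> * indicator {a..b} x"
      by (cases "x \<in> {a..b}") (auto intro!: tendsto_ennrealI)
    then show "ennreal \<bar>u x - mean u {a..b}\<bar> * indicator {a..b} x = liminf (\<lambda>B. ennreal \<bar>t B (u x) - mean (\<lambda>x. t B (u x)) {a..b}\<bar> * indicator {a..b} x)"
      by (simp add: lim_imp_Liminf)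
  qed
  also have "\<dots> \<le> liminf (\<lambda>B. \<integral>\<^sup>+x\<in>{a..b}. ennreal \<bar>t B (u x) - mean (\<lambda>x. t B (u x)) {a..b}\<bar> \<partial>dens w)"
    by (rule nn_integral_liminf) auto
  also have "\<dots> \<le> liminf (\<lambda>B::nat. ennreal (8 * \<kappa> * N) * emeasure (dens w) {a..b})"
    by (intro Liminf_mono always_eventually allI le)
  also have "\<dots> = ennreal (8 * \<kappa> * N) * emeasure (dens w) {a..b}"
    by (rule Liminf_const) simp
  finally show ?thesis .
qed

subsection \<open>Densities of absolutely continuous functions\<close>

text \<open>Puts components of a bounded open set into the endpoint form in which absolute
  continuity is stated.\<close>

lemma bounded_open_interval_real:
  fixes X :: "real set"
  assumes "open X" "is_interval X" "X \<noteq> {}" "bounded X"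
  shows "X = {Inf X<..<Sup X}" "Inf X < Sup X"
proof -
  have bd: "bdd_below X" "bdd_above X" using assms(4) by (auto simp: bounded_imp_bdd_below bounded_imp_bdd_above)
  have "\<exists>y z. y \<in> X \<and> z \<in> X \<and> y < x \<and> x < z" if x: "x \<in> X" for x
  proof -
    obtain e where "e > 0" "ball x e \<subseteq> X" by (rule openE[OF assms(1) x])
    then show ?thesis by (intro exI[of _ "x - e/2"] exI[of _ "x + e/2"]) (auto simp: dist_real_def subset_iff)
  qed
  then have 1: "Inf X < x \<and> x < Sup X" if "x \<in> X" for x
    using that bd by (meson cInf_lower cSup_upper le_less_trans less_le_trans)
  then show "Inf X < Sup X" using assms(3) by (metis ex_in_conv less_trans)
  have "x \<in> X" if x: "Inf X < x" "x < Sup X" for x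
  proof -
    obtain y z where "y \<in> X" "y < x" "z \<in> X" "x < z"
      using cInf_lessD[OF assms(3) x(1)] less_cSupD[OF assms(3) x(2)] by auto
    then show ?thesis using assms(2) unfolding is_interval_1 by (meson less_imp_le)
  qed
  with 1 show "X = {Inf X<..<Sup X}" by auto
qed

text \<open>A bounded part of a null set lies in an open set V of length below \<delta>. Any finite
  collection of components of V is a family of disjoint intervals as in the definition of absolute
  continuity, so its Stieltjes mass is at most \<epsilon>; exhausting V by such collections keeps
  the bound.\<close>

lemma interval_measure_absolutely_continuous:
  fixes h :: "real \<Rightarrow> real"
  assumes mono: "mono h" and cont: "continuous_on UNIV h" and ac: "locally_abs_continuous h"
  shows "absolutely_continuous lborel (interval_measure h)"
  unfolding absolutely_continuous_def
proof
  let ?\<mu> = "interval_measure h"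
  have ecc: "emeasure ?\<mu> {s..t} = ennreal (h t - h s)" if "s \<le> t" for s t
    using that mono cont by (intro emeasure_interval_measure_Icc) (auto simp: monoD)
  fix N :: "real set" assume N: "N \<in> null_sets lborel"
  have "emeasure ?\<mu> (N \<inter> {- real m<..<real m}) \<le> ennreal \<epsilon>" if \<epsilon>: "0 < \<epsilon>" and m: "0 < m" for m :: nat and \<epsilon>
  proof -
    have "abs_continuous_on_interval (- real m) (real m) h" using ac m by (simp add: locally_abs_continuous_def)
    then obtain \<delta> where \<delta>: "\<delta> > 0" and ac': "\<And>(n::nat) s t.
        (\<forall>i<n. - real m \<le> s i \<and> s i < t i \<and> t i \<le> real m) \<Longrightarrow>
        disjoint_family_on (\<lambda>i. {s i<..<t i}) {..<n} \<Longrightarrow>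
        (\<Sum>i<n. t i - s i) < \<delta> \<Longrightarrow> (\<Sum>i<n. \<bar>h (t i) - h (s i)\<bar>) < \<epsilon>"
      using \<epsilon> unfolding abs_continuous_on_interval_def by meson
    let ?N = "N \<inter> {- real m<..<real m}"
    have Nb: "N \<in> sets borel" using N by auto
    obtain U where U: "open U" "?N \<subseteq> U" "emeasure lborel (U - ?N) < ennreal \<delta>"
    proof (rule outer_regular_lborel[of ?N \<delta>])
      show "?N \<in> sets borel" using Nb by simp
    qed (use \<delta> in auto)
    \<comment> \<open>The intersection keeps all components inside [-m, m], where the chosen
      \<delta> is valid.\<close>
    define V where "V = U \<inter> {- real m<..<real m}"
    have V: "open V" "?N \<subseteq> V" "V \<subseteq> {- real m<..<real m}" using U by (auto simp: V_def)
    have Vb [measurable]: "V \<in> sets borel" using V by auto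
    have "emeasure lborel V \<le> emeasure lborel (?N \<union> (U - ?N))"
      using U Nb V by (intro emeasure_mono) (auto simp: V_def)
    also have "\<dots> \<le> emeasure lborel ?N + emeasure lborel (U - ?N)"
      using U Nb by (intro emeasure_subadditive) auto
    also have "emeasure lborel ?N = 0"
      by (rule emeasure_eq_0[of N lborel]) (use N in \<open>auto simp: null_sets_def\<close>)
    finally have Vd: "emeasure lborel V < ennreal \<delta>" using U(3) by simp
    define \<C> where "\<C> = components V"
    have comp: "open X" "is_interval X" "X \<noteq> {}" "bounded X" "X \<subseteq> V" if "X \<in> \<C>" for X
    proof -
      show "open X" using that V(1) open_components by (auto simp: \<C>_def)
      show "is_interval X" using that in_components_connected by (auto simp: \<C>_def is_interval_connected_1)
      show "X \<noteq> {}" using that in_components_nonempty by (auto simp: \<C>_def)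
      show "X \<subseteq> V" using that in_components_subset by (auto simp: \<C>_def)
      then show "bounded X" using V(3) bounded_subset[of "{- real m..real m}" X] by force
    qed
    have disj: "X \<inter> Y = {}" if "X \<in> \<C>" "Y \<in> \<C>" "X \<noteq> Y" for X Y
      using pairwise_disjoint_components that unfolding \<C>_def pairwise_def by blast
    have cC: "countable \<C>"
      by (rule countable_disjoint_open_subsets) (use comp disj in \<open>auto simp: pairwise_def disjnt_def\<close>)
    have fin: "emeasure ?\<mu> (\<Union>D) \<le> ennreal \<epsilon>" if D: "finite D" "D \<subseteq> \<C>" for D
    proof -
      obtain e where e: "bij_betw e {0..<card D} D" using ex_bij_betw_nat_finite[OF D(1)] by blast
      have eD: "e i \<in> \<C>" if "i < card D" for i using e that D(2) by (auto simp: bij_betw_def)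
      define s t where "s i = Inf (e i)" and "t i = Sup (e i)" for i
      have st: "e i = {s i<..<t i}" "s i < t i" if "i < card D" for i
        using bounded_open_interval_real[OF comp(1-4)[OF eD[OF that]]] by (auto simp: s_def t_def)
      have DU: "\<Union>D = (\<Union>i<card D. {s i<..<t i})"
        using e st by (auto simp: bij_betw_def atLeast0LessThan)
      have df: "disjoint_family_on (\<lambda>i. {s i<..<t i}) {..<card D}"
        unfolding disjoint_family_on_def
      proof (intro ballI impI)
        fix i j assume ij: "i \<in> {..<card D}" "j \<in> {..<card D}" "i \<noteq> j"
        then have "e i \<noteq> e j" using e unfolding bij_betw_def inj_on_def by (auto simp: atLeast0LessThan)
        then show "{s i<..<t i} \<inter> {s j<..<t j} = {}" using disj[OF eD eD] st ij by (metis lessThan_iff)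
      qed
      have inm: "- real m \<le> s i \<and> s i < t i \<and> t i \<le> real m" if "i < card D" for i
      proof -
        have "{s i<..<t i} \<subseteq> {- real m<..<real m}" using st[OF that] comp(5)[OF eD[OF that]] V(3) by auto
        then show ?thesis using st(2)[OF that] by (simp add: greaterThanLessThan_subseteq_greaterThanLessThan)
      qed
      have "(\<Sum>i<card D. ennreal (t i - s i)) = (\<Sum>i<card D. emeasure lborel {s i<..<t i})"
        by (intro sum.cong refl) (simp add: less_imp_le st(2))
      also have "\<dots> = emeasure lborel (\<Union>D)"
        unfolding DU by (rule sum_emeasure) (use df in auto)
      also have "\<dots> \<le> emeasure lborel V" using D comp(5) by (intro emeasure_mono) auto
      also have "\<dots> < ennreal \<delta>" by (rule Vd)
      finally have "(\<Sum>i<card D. t i - s i) < \<delta>"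
      proof (subst (asm) sum_ennreal)
        assume "ennreal (\<Sum>i<card D. t i - s i) < ennreal \<delta>"
        moreover have "0 \<le> (\<Sum>i<card D. t i - s i)"
          by (rule sum_nonneg) (simp add: less_imp_le st(2))
        ultimately show ?thesis by (simp only: ennreal_less_iff)
      qed (simp add: less_imp_le st(2))
      then have "(\<Sum>i<card D. \<bar>h (t i) - h (s i)\<bar>) < \<epsilon>" using inm df by (intro ac') auto
      then have le: "ennreal (\<Sum>i<card D. \<bar>h (t i) - h (s i)\<bar>) \<le> ennreal \<epsilon>"
        by (intro ennreal_leI) simp
      have "emeasure ?\<mu> (\<Union>D) \<le> (\<Sum>i<card D. emeasure ?\<mu> {s i<..<t i})"
        unfolding DU by (rule emeasure_subadditive_finite) auto
      also have "\<dots> \<le> (\<Sum>i<card D. ennreal \<bar>h (t i) - h (s i)\<bar>)"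
      proof (rule sum_mono)
        fix i assume "i \<in> {..<card D}"
        then have "s i \<le> t i" by (simp add: less_imp_le st(2))
        have "emeasure ?\<mu> {s i<..<t i} \<le> emeasure ?\<mu> {s i..t i}" by (rule emeasure_mono) auto
        then show "emeasure ?\<mu> {s i<..<t i} \<le> ennreal \<bar>h (t i) - h (s i)\<bar>"
          using ecc[OF \<open>s i \<le> t i\<close>] monoD[OF mono \<open>s i \<le> t i\<close>] by simp
      qed
      also have "\<dots> = ennreal (\<Sum>i<card D. \<bar>h (t i) - h (s i)\<bar>)"
        by (rule sum_ennreal) simp
      also have "\<dots> \<le> ennreal \<epsilon>" by (rule le)
      finally show ?thesis .
    qed
    have "emeasure ?\<mu> V \<le> ennreal \<epsilon>"
    proof (cases "\<C> = {}")
      case True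
      then have "V = {}" using Union_components[of V] by (simp add: \<C>_def)
      then show ?thesis by simp
    next
      case False
      define W where "W n = \<Union>(from_nat_into \<C> ` {..<n})" for n
      have inC: "from_nat_into \<C> ` {..<n} \<subseteq> \<C>" for n using from_nat_into[OF False] by auto
      have "V = \<Union>(range (from_nat_into \<C>))" using range_from_nat_into[OF False cC] by (simp add: \<C>_def)
      also have "\<dots> = (\<Union>n. W n)" unfolding W_def by auto
      finally have "emeasure ?\<mu> V = emeasure ?\<mu> (\<Union>n. W n)" by simp
      also have "\<dots> = (SUP n. emeasure ?\<mu> (W n))"
      proof (rule SUP_emeasure_incseq[symmetric])
        have "open (W n)" for n unfolding W_def using inC comp(1) by blast
        then show "range W \<subseteq> sets ?\<mu>" by auto
        show "incseq W" unfolding W_def incseq_def by (intro allI impI Union_mono image_mono) auto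
      qed
      also have "\<dots> \<le> ennreal \<epsilon>" using fin inC by (intro SUP_least) (auto simp: W_def)
      finally show ?thesis .
    qed
    moreover have "emeasure ?\<mu> ?N \<le> emeasure ?\<mu> V" using V by (intro emeasure_mono) auto
    ultimately show ?thesis by (rule order_trans[rotated])
  qed
  then have z: "emeasure ?\<mu> (N \<inter> {- real (Suc m)<..<real (Suc m)}) = 0" for m
    by (metis ennreal_le_epsilon add_0 le_zero_eq zero_less_Suc)
  have Nb: "N \<in> sets borel" using N by auto
  have "emeasure ?\<mu> (\<Union>m. N \<inter> {- real (Suc m)<..<real (Suc m)}) = 0"
    using z Nb by (intro emeasure_UN_eq_0) auto
  moreover have "(\<Union>m. N \<inter> {- real (Suc m)<..<real (Suc m)}) = N"
  proof -
    have "\<exists>m. - real (Suc m) < x \<and> x < real (Suc m)" for x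
    proof -
      obtain m :: nat where "\<bar>x\<bar> < real m" using reals_Archimedean2 by blast
      then show ?thesis by (intro exI[of _ m]) auto
    qed
    then show ?thesis by auto
  qed
  ultimately show "N \<in> null_sets ?\<mu>" using Nb by auto
qed

text \<open>The density is the Radon--Nikodym derivative of the Stieltjes measure of h. Bounded
  intervals have finite mass, so it is infinite only on a null set, and \<open>enn2real\<close>
  makes it real there.\<close>

lemma abs_continuous_density:
  fixes h :: "real \<Rightarrow> real"
  assumes mono: "mono h" and cont: "continuous_on UNIV h" and ac: "locally_abs_continuous h"
  obtains w where "loc_weight w" "\<And>a b. a \<le> b \<Longrightarrow> measure (dens w) {a..b} = h b - h a"
proof -
  let ?\<mu> = "interval_measure h"
  have ecc: "emeasure ?\<mu> {s..t} = ennreal (h t - h s)" if "s \<le> t" for s t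
    using that mono cont by (intro emeasure_interval_measure_Icc) (auto simp: monoD)
  obtain f where f: "f \<in> borel_measurable lborel" "density lborel f = ?\<mu>"
    using sigma_finite_measure.Radon_Nikodym[OF sigma_finite_lborel interval_measure_absolutely_continuous[OF assms]] by auto
  have fin: "(\<integral>\<^sup>+x. f x * indicator {a..b} x \<partial>lborel) \<noteq> \<infinity>" for a b
  proof (cases "a \<le> b")
    case True
    have "(\<integral>\<^sup>+x. f x * indicator {a..b} x \<partial>lborel) = ennreal (h b - h a)"
      using emeasure_density[OF f(1), of "{a..b}"] unfolding f(2) ecc[OF True] by simp
    then show ?thesis by simp
  qed auto
  have "AE x in lborel. \<forall>n::nat. f x * indicator {- real n..real n} x \<noteq> \<infinity>"
    unfolding AE_all_countable using fin f(1) by (intro allI nn_integral_PInf_AE) auto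
  then have "AE x in lborel. f x \<noteq> \<infinity>"
  proof eventually_elim
    case (elim x)
    obtain n :: nat where "\<bar>x\<bar> \<le> real n" using real_arch_simple by blast
    then have "x \<in> {- real n..real n}" by auto
    then show ?case using elim[rule_format, of n] by simp
  qed
  then have AEf: "AE x in lborel. f x = ennreal (enn2real (f x))"
    by eventually_elim (simp add: less_top)
  define w where "w x = enn2real (f x)" for x
  have wm [measurable]: "w \<in> borel_measurable borel" using f(1) unfolding w_def by simp
  have w0: "0 \<le> w x" for x by (simp add: w_def)
  have "dens w = ?\<mu>" unfolding f(2)[symmetric] dens_def
    by (rule density_cong) (use f(1) AEf in \<open>auto simp: w_def\<close>)
  moreover have "loc_weight w"
    unfolding loc_weight_def
  proof (intro conjI allI)
    fix a b
    have "(\<integral>\<^sup>+x. ennreal (indicator {a..b} x *\<^sub>R w x) \<partial>lborel) = (\<integral>\<^sup>+x. f x * indicator {a..b} x \<partial>lborel)"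
      by (rule nn_integral_cong_AE) (use AEf in \<open>eventually_elim, auto simp: w_def indicator_def\<close>)
    then show "set_integrable lborel {a..b} w"
      unfolding set_integrable_def using fin[of a b] by (intro integrableI_nonneg) (auto simp: w0 less_top)
  qed (auto simp: w_def)
  ultimately show ?thesis
    using that[of w] ecc monoD[OF mono] by (simp add: measure_def)
qed

subsection \<open>Strongly symmetric homeomorphisms in terms of densities\<close>

text \<open>The A-infinity inequality read backwards: if t is the share of length, a share \<kappa>
  of mass forces \<kappa> \<le> C t^\<alpha>, which is solved for t. In this form it is applied to
  complements.\<close>

lemma A_inf_bound_measure_ge:
  assumes A: "A_inf_bound w C \<alpha>" and C: "0 < C" "0 < \<alpha>"
    and F: "c < d" "F \<in> sets borel" "F \<subseteq> {c..d}"
    and pos: "0 < measure (dens w) {c..d}" and \<kappa>: "0 \<le> \<kappa>"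
    and le: "\<kappa> * measure (dens w) {c..d} \<le> measure (dens w) F"
  shows "(\<kappa> / C) powr (1 / \<alpha>) * (d - c) \<le> measure lborel F"
proof -
  define t where "t = measure lborel F / (d - c)"
  have t: "0 \<le> t" using F by (simp add: t_def)
  have "\<kappa> * measure (dens w) {c..d} \<le> C * t powr \<alpha> * measure (dens w) {c..d}"
    using le A_inf_boundD[OF A F] by (simp add: t_def)
  then have "\<kappa> \<le> C * t powr \<alpha>" using pos by simp
  then have "\<kappa> / C \<le> t powr \<alpha>" using C by (simp add: pos_divide_le_eq mult.commute)
  then have "(\<kappa> / C) powr (1 / \<alpha>) \<le> (t powr \<alpha>) powr (1 / \<alpha>)"
    using C \<kappa> by (intro powr_mono2) auto
  also have "\<dots> = t" using t C by (simp add: powr_powr)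
  finally show ?thesis using F(1) by (simp add: t_def pos_le_divide_eq)
qed

lemma measure_Icc_minus:
  assumes w: "loc_weight w" and F: "F \<in> sets borel"
  shows "measure (dens w) ({c..d} - F) + measure (dens w) (F \<inter> {c..d}) = measure (dens w) {c..d}"
proof -
  have "emeasure (dens w) ({c..d} - F) + emeasure (dens w) (F \<inter> {c..d}) = emeasure (dens w) {c..d}"
    using F by (subst plus_emeasure) (auto intro: arg_cong[where f="emeasure _"])
  then show ?thesis
    using emeasure_dens_eq_measure[OF w, of "{c..d} - F" c d] emeasure_dens_eq_measure[OF w, of "F \<inter> {c..d}" c d]
      emeasure_dens_eq_measure[OF w, of "{c..d}" c d] F
    by (auto simp flip: ennreal_plus)
qed

text \<open>The zero set E carries no w-mass, so in every interval its complement has full mass and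
  hence at least the share \<delta> of the length. Thus E has density at most 1 - \<delta> in every
  interval, which differentiation of its indicator permits only for null sets.\<close>

lemma A_inf_weight_pos_AE:
  assumes w: "loc_weight w" and A: "A_inf_bound w C \<alpha>" and C: "0 < C" "0 < \<alpha>"
    and pos: "\<And>c d. c < d \<Longrightarrow> 0 < measure (dens w) {c..d}"
  shows "AE x in lborel. 0 < w x"
proof -
  have wm [measurable]: "w \<in> borel_measurable borel" using w by (simp add: loc_weight_def)
  define E where "E = {x. w x = 0}"
  have Eb [measurable]: "E \<in> sets borel" unfolding E_def by measurable
  have iE: "loc_weight (indicator E)" by (rule loc_weight_indicator[OF Eb])
  \<comment> \<open>The share of length forced by carrying the full mass of an interval.\<close>
  define \<delta> where "\<delta> = (1 / C) powr (1 / \<alpha>)"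
  have \<delta>: "0 < \<delta>" using C by (simp add: \<delta>_def)
  have sparse: "measure (dens (indicator E)) {c..d} \<le> (1 - \<delta>) * (d - c)" if cd: "c < d" for c d
  proof -
    have "emeasure (dens w) (E \<inter> {c..d}) = (\<integral>\<^sup>+x\<in>E \<inter> {c..d}. ennreal (w x) \<partial>lborel)"
      unfolding dens_def by (rule emeasure_density) auto
    also have "\<dots> = (\<integral>\<^sup>+x. 0 \<partial>(lborel :: real measure))"
      by (intro nn_integral_cong) (auto simp: indicator_def E_def)
    finally have "measure (dens w) (E \<inter> {c..d}) = 0" by (simp add: measure_def)
    then have "measure (dens w) ({c..d} - E) = measure (dens w) {c..d}"
      using measure_Icc_minus[OF w Eb, of c d] by simp
    then have "\<delta> * (d - c) \<le> measure lborel ({c..d} - E)"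
      unfolding \<delta>_def using cd pos[OF cd] by (intro A_inf_bound_measure_ge[OF A C]) auto
    moreover have "measure lborel ({c..d} - E) + measure lborel (E \<inter> {c..d}) = d - c"
      using measure_Icc_minus[OF loc_weight_1 Eb, of c d] cd by (simp add: dens_1)
    ultimately show ?thesis
      using emeasure_dens_indicator[OF Eb, of "{c..d}"] by (simp add: measure_def algebra_simps)
  qed
  obtain G where G: "\<And>c d. c \<le> d \<Longrightarrow> G d - G c = measure (dens (indicator E)) {c..d}"
    and dG: "AE x in lborel. (G has_real_derivative indicator E x) (at x)"
    using loc_weight_primitive[OF iE] by blast
  from dG show ?thesis
  proof eventually_elim
    case (elim x)
    have "indicator E x \<le> 1 - \<delta>"
    proof (rule has_derivative_le_straddle[OF elim])
      fix \<epsilon> :: real assume "\<epsilon> > 0"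
      then show "\<exists>c d. c \<le> x \<and> x \<le> d \<and> c < d \<and> d - c < \<epsilon> \<and> G d - G c \<le> (1 - \<delta>) * (d - c)"
        using sparse[of x "x + \<epsilon> / 2"] G[of x "x + \<epsilon> / 2"] by (intro exI[of _ x] exI[of _ "x + \<epsilon> / 2"]) auto
    qed
    then have "x \<notin> E" using \<delta> by (auto simp: indicator_def split: if_splits)
    then show ?case using loc_weight_nonneg[OF w, of x] by (auto simp: E_def less_le)
  qed
qed

text \<open>The sets as well as the functions may differ by a null set, so that a Lebesgue
  measurable set can be exchanged for a Borel one.\<close>

lemma set_integral_lebesgue_cong_AE:
  fixes f g :: "real \<Rightarrow> real"
  assumes "f \<in> borel_measurable lebesgue" "g \<in> borel_measurable lebesgue" "AE x in lebesgue. f x = g x"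
    and "E \<in> sets lebesgue" "F \<in> sets lebesgue" "AE x in lebesgue. x \<in> E \<longleftrightarrow> x \<in> F"
  shows "(LINT x:E|lebesgue. f x) = (LINT x:F|lebesgue. g x)"
  unfolding set_lebesgue_integral_def
proof (rule integral_cong_AE)
  show "(\<lambda>x. indicat_real E x *\<^sub>R f x) \<in> borel_measurable lebesgue"
    using assms by (intro borel_measurable_scaleR borel_measurable_indicator) auto
  show "(\<lambda>x. indicat_real F x *\<^sub>R g x) \<in> borel_measurable lebesgue"
    using assms by (intro borel_measurable_scaleR borel_measurable_indicator) auto
  show "AE x in lebesgue. indicat_real E x *\<^sub>R f x = indicat_real F x *\<^sub>R g x"
    using assms(3,6) by eventually_elim (simp add: indicator_def)
qed

lemma borel_measurable_lebesgueI:
  fixes f :: "real \<Rightarrow> real"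
  shows "f \<in> borel_measurable borel \<Longrightarrow> f \<in> borel_measurable lebesgue"
  by (rule measurable_completion) simp

text \<open>The bridge from integrals of a derivative, as in \<open>A_infinity_weight\<close>, to
  the measures used in the estimates.\<close>

lemma measure_dens_lebesgue:
  assumes w: "loc_weight w" and f: "f \<in> borel_measurable lebesgue" "AE x in lebesgue. f x = w x"
    and E: "E \<in> sets borel" "E \<subseteq> {a..b}"
  shows "(LINT x:E|lebesgue. f x) = measure (dens w) E"
proof -
  have wm: "w \<in> borel_measurable borel" using w by (simp add: loc_weight_def)
  have "(LINT x:E|lebesgue. f x) = (LINT x:E|lebesgue. w x)"
    using E by (intro set_integral_lebesgue_cong_AE f borel_measurable_lebesgueI wm) auto
  also have "\<dots> = (LINT x:E|lborel. w x)" by (rule set_integral_lebesgue[OF wm E(1)])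
  also have "\<dots> = measure (dens w) E" by (rule measure_dens[OF w E(2,1), symmetric])
  finally show ?thesis .
qed

lemma mean_cong_AE:
  assumes "u \<in> borel_measurable lebesgue" "v \<in> borel_measurable lebesgue" "AE x in lebesgue. u x = v x"
  shows "mean u {a..b} = mean v {a..b}"
  unfolding mean_def using set_integral_lebesgue_cong_AE[OF assms, of "{a..b}" "{a..b}"] by simp

lemma mean_oscillation_cong_AE:
  assumes u: "u \<in> borel_measurable lebesgue" and v: "v \<in> borel_measurable lebesgue"
    and uv: "AE x in lebesgue. u x = v x"
  shows "mean_oscillation u {a..b} = mean_oscillation v {a..b}"
  unfolding mean_oscillation_def mean_cong_AE[OF assms]
proof (rule mean_cong_AE)
  show "(\<lambda>x. \<bar>u x - mean v {a..b}\<bar>) \<in> borel_measurable lebesgue" "(\<lambda>x. \<bar>v x - mean v {a..b}\<bar>) \<in> borel_measurable lebesgue"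
    using u v by measurable
qed (use uv in eventually_elim, simp)

lemma VMO_cong_AE:
  assumes u: "u \<in> VMO" and v: "v \<in> borel_measurable lebesgue" and uv: "AE x in lebesgue. u x = v x"
  shows "v \<in> VMO"
proof -
  have um: "u \<in> borel_measurable lebesgue" and ui: "\<And>a b. set_integrable lebesgue {a..b} u"
    using u by (auto simp: VMO_def BMO_def locally_integrable_def)
  have "set_integrable lebesgue {a..b} v" for a b
  proof -
    have "integrable lebesgue (\<lambda>x. indicat_real {a..b} x *\<^sub>R u x) \<longleftrightarrow> integrable lebesgue (\<lambda>x. indicat_real {a..b} x *\<^sub>R v x)"
    proof (rule integrable_cong_AE)
      show "(\<lambda>x. indicat_real {a..b} x *\<^sub>R u x) \<in> borel_measurable lebesgue"
        using um by (intro borel_measurable_scaleR borel_measurable_indicator) auto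
      show "(\<lambda>x. indicat_real {a..b} x *\<^sub>R v x) \<in> borel_measurable lebesgue"
        using v by (intro borel_measurable_scaleR borel_measurable_indicator) auto
      show "AE x in lebesgue. indicat_real {a..b} x *\<^sub>R u x = indicat_real {a..b} x *\<^sub>R v x"
        using uv by eventually_elim simp
    qed
    then show ?thesis using ui[of a b] by (simp add: set_integrable_def)
  qed
  then show ?thesis
    using u v mean_oscillation_cong_AE[OF um v uv] by (simp add: VMO_def BMO_def locally_integrable_def)
qed

text \<open>Here w is a version of h'. Positivity at every point, instead of almost everywhere,
  makes p / w and ln (p / w) = ln p - ln w valid pointwise, so no null set has to be followed
  through the composition with k.\<close>

definition A_inf_density :: "(real \<Rightarrow> real) \<Rightarrow> (real \<Rightarrow> real) \<Rightarrow> bool" where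
  "A_inf_density h w \<longleftrightarrow> loc_weight w \<and> (\<forall>x. 0 < w x) \<and>
     (\<forall>a b. a \<le> b \<longrightarrow> measure (dens w) {a..b} = h b - h a) \<and>
     (\<exists>C>0. \<exists>\<alpha>>0. A_inf_bound w C \<alpha>)"

lemma AE_deriv_eq_density:
  assumes w: "loc_weight w" and h: "\<And>a b. a \<le> b \<Longrightarrow> measure (dens w) {a..b} = h b - h a"
  shows "AE x in lebesgue. deriv h x = w x"
proof -
  have int: "w integrable_on {c..d}" for c d
    using set_borel_integral_eq_integral(1)[of "{c..d}" w] w by (auto simp: loc_weight_def)
  have "h d - h c = integral {c..d} w" if "c \<le> d" for c d
    using h[OF that] w by (simp add: measure_dens[OF w subset_refl] set_borel_integral_eq_integral(2) loc_weight_def)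
  then have "AE x in lebesgue. (h has_real_derivative w x) (at x)"
    by (intro AE_has_derivative_integral int)
  then show ?thesis by eventually_elim (rule DERIV_imp_deriv)
qed

text \<open>Absolute continuity provides a density, and differentiation identifies it with
  \<open>deriv h\<close> almost everywhere, so the A-infinity and VMO conditions carry over. The
  A-infinity condition makes it positive almost everywhere, hence everywhere after a change on a
  null set.\<close>

lemma SS_density:
  assumes "h \<in> SS"
  obtains w where "A_inf_density h w" "(\<lambda>x. ln (w x)) \<in> VMO"
proof -
  have mono: "strict_mono h" and hom: "homeomorphism UNIV UNIV h (inv h)" and ac: "locally_abs_continuous h"
    and Aw: "A_infinity_weight (deriv h)" and V: "(\<lambda>x. ln (deriv h x)) \<in> VMO"
    using assms by (auto simp: SS_def)
  have cont: "continuous_on UNIV h" using hom by (rule homeomorphism_cont1)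
  obtain w0 where w0: "loc_weight w0" and hw0: "\<And>a b. a \<le> b \<Longrightarrow> measure (dens w0) {a..b} = h b - h a"
    using abs_continuous_density[OF strict_mono_mono[OF mono] cont ac] by blast
  have dw0: "AE x in lebesgue. deriv h x = w0 x" by (rule AE_deriv_eq_density[OF w0 hw0])
  have dm: "deriv h \<in> borel_measurable lebesgue"
    using Aw by (simp add: A_infinity_weight_def weight_def locally_integrable_def)
  have pos0: "0 < measure (dens w0) {c..d}" if "c < d" for c d
    using hw0[of c d] that strict_monoD[OF mono that] by simp
  obtain C \<alpha> where C: "0 < C" "0 < \<alpha>" and Ab: "\<And>a b E. a < b \<Longrightarrow> E \<in> sets lebesgue \<Longrightarrow> E \<subseteq> {a..b} \<Longrightarrow>
      (LINT x:E|lebesgue. deriv h x) / (LINT x:{a..b}|lebesgue. deriv h x)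
             \<le> C * (measure lebesgue E / measure lebesgue {a..b}) powr \<alpha>"
    using Aw unfolding A_infinity_weight_def by meson
  have A0: "A_inf_bound w0 C \<alpha>"
    unfolding A_inf_bound_def
  proof (intro allI impI)
    fix c d :: real and F assume cd: "c < d" and F: "F \<in> sets borel" "F \<subseteq> {c..d}"
    have "measure (dens w0) F / measure (dens w0) {c..d} \<le> C * (measure lborel F / (d - c)) powr \<alpha>"
      using Ab[OF cd _ F(2)] cd F measure_dens_lebesgue[OF w0 dm dw0 F] measure_dens_lebesgue[OF w0 dm dw0, of "{c..d}" c d]
      by (simp add: measure_completion)
    then show "measure (dens w0) F \<le> C * (measure lborel F / (d - c)) powr \<alpha> * measure (dens w0) {c..d}"
      using pos0[OF cd] by (simp add: pos_divide_le_eq)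
  qed
  have p: "AE x in lborel. 0 < w0 x" by (rule A_inf_weight_pos_AE[OF w0 A0 C pos0])
  \<comment> \<open>Any positive value would do in place of 1: the change affects a null set only
    and leaves the measure as it is.\<close>
  define w where "w x = (if 0 < w0 x then w0 x else 1)" for x
  have w0m [measurable]: "w0 \<in> borel_measurable borel" using w0 by (simp add: loc_weight_def)
  have wm [measurable]: "w \<in> borel_measurable borel" unfolding w_def by measurable
  have eq: "AE x in lborel. w0 x = w x" using p by eventually_elim (simp add: w_def)
  have deq: "dens w = dens w0"
    unfolding dens_def using eq by (intro density_cong) (auto elim: eventually_mono)
  have "loc_weight w"
    unfolding loc_weight_def
  proof (intro conjI allI)
    fix a b
    have "integrable lborel (\<lambda>x. indicat_real {a..b} x *\<^sub>R w0 x) \<longleftrightarrow> integrable lborel (\<lambda>x. indicat_real {a..b} x *\<^sub>R w x)"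
      using eq by (intro integrable_cong_AE) (auto elim: eventually_mono)
    then show "set_integrable lborel {a..b} w" using w0 by (simp add: loc_weight_def set_integrable_def)
  qed (auto simp: w_def)
  moreover have "\<forall>x. 0 < w x" by (simp add: w_def)
  ultimately have "A_inf_density h w"
    using A0 C hw0 unfolding A_inf_density_def A_inf_bound_def deq by blast
  moreover have "(\<lambda>x. ln (w x)) \<in> VMO"
  proof (rule VMO_cong_AE[OF V])
    show "(\<lambda>x. ln (w x)) \<in> borel_measurable lebesgue" by (rule borel_measurable_lebesgueI) measurable
    have "AE x in lebesgue. w0 x = w x" using eq by (simp add: AE_completion_iff)
    with dw0 show "AE x in lebesgue. ln (deriv h x) = ln (w x)" by eventually_elim simp
  qed
  ultimately show ?thesis by (rule that)
qed

text \<open>Local absolute continuity comes from the power bound, applied to a finite union of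
  disjoint open intervals whose r-mass is the sum of the increments of f. The conditions on the
  derivative transfer because \<open>deriv f\<close> equals r almost everywhere.\<close>

lemma SS_if_density:
  assumes mono: "strict_mono f" and hom: "homeomorphism UNIV UNIV f (inv f)"
    and D: "A_inf_density f r" and V: "(\<lambda>x. ln (r x)) \<in> VMO"
  shows "f \<in> SS"
proof -
  have r: "loc_weight r" and rpos: "\<And>x. 0 < r x" and fr: "\<And>a b. a \<le> b \<Longrightarrow> measure (dens r) {a..b} = f b - f a"
    using D by (auto simp: A_inf_density_def)
  obtain C \<alpha> where C: "0 < C" "0 < \<alpha>" and A: "A_inf_bound r C \<alpha>" using D by (auto simp: A_inf_density_def)
  have rm [measurable]: "r \<in> borel_measurable borel" using r by (simp add: loc_weight_def)
  have dr: "AE x in lebesgue. deriv f x = r x" by (rule AE_deriv_eq_density[OF r fr])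
  have rl: "r \<in> borel_measurable lebesgue" by (rule borel_measurable_lebesgueI[OF rm])
  have "AE x in lebesgue. r x = deriv f x" using dr by eventually_elim simp
  then have dm: "deriv f \<in> borel_measurable lebesgue" by (rule borel_measurable_AE[OF rl])
  have pos: "0 < measure (dens r) {a..b}" if "a < b" for a b
    using fr[of a b] that strict_monoD[OF mono that] by simp
  have mo: "measure (dens r) {a<..<b} = measure (dens r) {a..b}" for a b
  proof (rule measure_eq_AE)
    have "AE x in lborel. x \<noteq> a \<and> x \<noteq> b" by (intro AE_conjI AE_lborel_singleton)
    then show "AE x in dens r. (x \<in> {a<..<b}) = (x \<in> {a..b})"
      by (intro AE_dens rm) (auto elim: eventually_mono)
  qed auto
  have "locally_abs_continuous f"
    unfolding locally_abs_continuous_def abs_continuous_on_interval_def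
  proof (intro allI impI)
    fix a b \<epsilon> :: real assume ab: "a < b" and \<epsilon>: "\<epsilon> > 0"
    define M where "M = measure (dens r) {a..b}"
    have M: "0 < M" using pos[OF ab] by (simp add: M_def)
    \<comment> \<open>The share s of [a,b] that the intervals may fill solves C s^\<alpha> M =
      \<epsilon>, that is, s^\<alpha> = q.\<close>
    define q where "q = \<epsilon> / (C * M)"
    have q: "0 < q" using \<epsilon> C M by (simp add: q_def)
    show "\<exists>\<delta>>0. \<forall>(n::nat) s t. (\<forall>i<n. a \<le> s i \<and> s i < t i \<and> t i \<le> b) \<and>
        disjoint_family_on (\<lambda>i. {s i<..<t i}) {..<n} \<and> (\<Sum>i<n. t i - s i) < \<delta>
        \<longrightarrow> (\<Sum>i<n. \<bar>f (t i) - f (s i)\<bar>) < \<epsilon>"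
    proof (intro exI[of _ "(b - a) * q powr (1 / \<alpha>)"] conjI allI impI)
      show "0 < (b - a) * q powr (1 / \<alpha>)" using ab q by simp
    next
      fix n :: nat and s t
      assume "(\<forall>i<n. a \<le> s i \<and> s i < t i \<and> t i \<le> b) \<and>
        disjoint_family_on (\<lambda>i. {s i<..<t i}) {..<n} \<and> (\<Sum>i<n. t i - s i) < (b - a) * q powr (1 / \<alpha>)"
      then have st: "\<And>i. i < n \<Longrightarrow> a \<le> s i \<and> s i < t i \<and> t i \<le> b"
        and disj: "disjoint_family_on (\<lambda>i. {s i<..<t i}) {..<n}"
        and small: "(\<Sum>i<n. t i - s i) < (b - a) * q powr (1 / \<alpha>)" by auto
      define F where "F = (\<Union>i<n. {s i<..<t i})"
      have F: "F \<in> sets borel" "F \<subseteq> {a..b}" using st by (force simp: F_def)+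
      have "measure (dens r) F = (\<Sum>i<n. measure (dens r) {s i<..<t i})"
        unfolding F_def
      proof (rule measure_finite_Union)
        show "emeasure (dens r) {s i<..<t i} \<noteq> \<infinity>" for i
          by (subst emeasure_dens_eq_measure[OF r, of _ "s i" "t i"]) auto
      qed (use disj in auto)
      also have "\<dots> = (\<Sum>i<n. \<bar>f (t i) - f (s i)\<bar>)"
      proof (rule sum.cong)
        fix i assume "i \<in> {..<n}"
        then have "s i < t i" using st by simp
        then show "measure (dens r) {s i<..<t i} = \<bar>f (t i) - f (s i)\<bar>"
          using mo fr[of "s i" "t i"] strict_monoD[OF mono] by (simp add: less_imp_le)
      qed simp
      finally have rF: "measure (dens r) F = (\<Sum>i<n. \<bar>f (t i) - f (s i)\<bar>)" .
      have "measure lborel F = (\<Sum>i<n. measure lborel {s i<..<t i})"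
        unfolding F_def
      proof (rule measure_finite_Union)
        show "emeasure lborel {s i<..<t i} \<noteq> \<infinity>" for i
          by (subst emeasure_lborel_eq_measure[of _ "s i" "t i"]) auto
      qed (use disj in auto)
      also have "\<dots> = (\<Sum>i<n. t i - s i)" using st by (intro sum.cong) (auto simp: less_imp_le)
      finally have "measure lborel F / (b - a) < q powr (1 / \<alpha>)"
        using small ab by (simp add: pos_divide_less_eq mult.commute)
      then have "(measure lborel F / (b - a)) powr \<alpha> < (q powr (1 / \<alpha>)) powr \<alpha>"
        using C ab by (intro powr_less_mono2) auto
      also have "\<dots> = q" using q C by (simp add: powr_powr)
      finally have "C * (measure lborel F / (b - a)) powr \<alpha> * M < C * q * M"
        using C M by simp
      also have "\<dots> = \<epsilon>" using C M by (simp add: q_def)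
      finally show "(\<Sum>i<n. \<bar>f (t i) - f (s i)\<bar>) < \<epsilon>"
        using A_inf_boundD[OF A ab F] by (simp add: rF M_def)
    qed
  qed
  moreover have "A_infinity_weight (deriv f)"
    unfolding A_infinity_weight_def
  proof
    have "set_integrable lebesgue {a..b} (deriv f)" for a b
    proof -
      have "integrable lebesgue (\<lambda>x. indicat_real {a..b} x *\<^sub>R deriv f x) \<longleftrightarrow> integrable lebesgue (\<lambda>x. indicat_real {a..b} x *\<^sub>R r x)"
      proof (rule integrable_cong_AE)
        show "(\<lambda>x. indicat_real {a..b} x *\<^sub>R deriv f x) \<in> borel_measurable lebesgue"
          using dm by (intro borel_measurable_scaleR borel_measurable_indicator) auto
        show "(\<lambda>x. indicat_real {a..b} x *\<^sub>R r x) \<in> borel_measurable lebesgue"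
          using rl by (intro borel_measurable_scaleR borel_measurable_indicator) auto
        show "AE x in lebesgue. indicat_real {a..b} x *\<^sub>R deriv f x = indicat_real {a..b} x *\<^sub>R r x"
          using dr by eventually_elim simp
      qed
      moreover have "set_integrable lebesgue {a..b} r"
        using r by (simp add: set_integrable_lebesgue_iff loc_weight_def)
      ultimately show ?thesis by (simp add: set_integrable_def)
    qed
    moreover have "AE x in lebesgue. 0 \<le> deriv f x"
      using dr by eventually_elim (simp add: less_imp_le rpos)
    ultimately show "weight (deriv f)" using dm by (simp add: weight_def locally_integrable_def)
  next
    show "\<exists>C>0. \<exists>\<alpha>>0. \<forall>a b. a < b \<longrightarrow>
        0 < (LINT x:{a..b}|lebesgue. deriv f x) \<and>
        (\<forall>E\<in>sets lebesgue. E \<subseteq> {a..b} \<longrightarrow>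
           (LINT x:E|lebesgue. deriv f x) / (LINT x:{a..b}|lebesgue. deriv f x)
             \<le> C * (measure lebesgue E / measure lebesgue {a..b}) powr \<alpha>)"
    proof (rule exI[of _ C], rule conjI[OF C(1)], rule exI[of _ \<alpha>], rule conjI[OF C(2)], intro conjI allI impI ballI)
      fix a b :: real assume ab: "a < b"
      have I: "(LINT x:{a..b}|lebesgue. deriv f x) = measure (dens r) {a..b}"
        by (rule measure_dens_lebesgue[OF r dm dr]) auto
      then show "0 < (LINT x:{a..b}|lebesgue. deriv f x)" using pos[OF ab] by simp
      fix E :: "real set" assume E: "E \<in> sets lebesgue" "E \<subseteq> {a..b}"
      \<comment> \<open>The power bound speaks of Borel sets; S is a Borel set that differs from E
        by a null set.\<close>
      obtain S N N' where S: "E = S \<union> N" "N \<subseteq> N'" "N' \<in> null_sets lborel" "S \<in> sets lborel"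
        using sets_completionE[OF E(1)] by blast
      have "AE x in lebesgue. x \<notin> N'" using AE_completion[OF AE_not_in[OF S(3)]] .
      then have ES: "AE x in lebesgue. x \<in> E \<longleftrightarrow> x \<in> S" by eventually_elim (use S in auto)
      have Sb: "S \<in> sets borel" "S \<in> sets lebesgue" "S \<subseteq> {a..b}" using S E by auto
      have "(LINT x:E|lebesgue. deriv f x) = (LINT x:S|lebesgue. deriv f x)"
        by (rule set_integral_lebesgue_cong_AE) (use dm E Sb ES in auto)
      also have "\<dots> = measure (dens r) S" by (rule measure_dens_lebesgue[OF r dm dr Sb(1,3)])
      also have "\<dots> \<le> C * (measure lborel S / (b - a)) powr \<alpha> * measure (dens r) {a..b}"
        by (rule A_inf_boundD[OF A ab Sb(1,3)])
      also have "measure lborel S = measure lebesgue E"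
        using measure_eq_AE[OF ES E(1) Sb(2)] Sb by (simp add: measure_completion)
      finally show "(LINT x:E|lebesgue. deriv f x) / (LINT x:{a..b}|lebesgue. deriv f x)
             \<le> C * (measure lebesgue E / measure lebesgue {a..b}) powr \<alpha>"
        using pos[OF ab] ab by (simp add: I pos_divide_le_eq)
    qed
  qed
  moreover have "(\<lambda>x. ln (deriv f x)) \<in> VMO"
  proof (rule VMO_cong_AE[OF V])
    show "(\<lambda>x. ln (deriv f x)) \<in> borel_measurable lebesgue" using dm by measurable
    show "AE x in lebesgue. ln (r x) = ln (deriv f x)" using dr by eventually_elim simp
  qed
  ultimately show ?thesis using mono hom by (simp add: SS_def)
qed

subsection \<open>Composition with the inverse\<close>

lemma vimage_Icc_homeomorphism:
  fixes h :: "real \<Rightarrow> real"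
  assumes "strict_mono h" "homeomorphism UNIV UNIV h (inv h)"
  shows "h -` {c..d} = {inv h c..inv h d}" "h -` {c<..<d} = {inv h c<..<inv h d}"
    and "strict_mono (inv h)" "h (inv h y) = y" "inv h (h x) = x"
proof -
  show hk: "h (inv h y) = y" for y using homeomorphism_apply2[OF assms(2)] by simp
  show kh: "inv h (h x) = x" for x using homeomorphism_apply1[OF assms(2)] by simp
  have "c \<le> h x \<longleftrightarrow> inv h c \<le> x" "h x \<le> c \<longleftrightarrow> x \<le> inv h c" for c x
    using strict_mono_less_eq[OF assms(1)] hk by metis+
  then show "h -` {c..d} = {inv h c..inv h d}" "h -` {c<..<d} = {inv h c<..<inv h d}"
    by (auto simp: vimage_def simp flip: not_le)
  show "strict_mono (inv h)"
    using strict_mono_less[OF assms(1)] hk by (intro strict_monoI) metis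
qed

text \<open>Lebesgue measure is determined by its values on open intervals, and the preimage of
  (l,u) has w-mass h(k(u)) - h(k(l)) = u - l.\<close>

lemma distr_dens_homeomorphism:
  fixes h :: "real \<Rightarrow> real"
  assumes h: "strict_mono h" "homeomorphism UNIV UNIV h (inv h)"
    and D: "A_inf_density h w"
  shows "distr (dens w) borel h = lborel"
proof (rule lborel_eqI[symmetric])
  have hm [measurable]: "h \<in> borel_measurable borel"
    using homeomorphism_cont1[OF h(2)] by (rule borel_measurable_continuous_onI)
  have w: "loc_weight w" "\<And>x. 0 < w x" and hw: "\<And>a b. a \<le> b \<Longrightarrow> measure (dens w) {a..b} = h b - h a"
    using D by (auto simp: A_inf_density_def)
  then have wm: "w \<in> borel_measurable borel" by (simp add: loc_weight_def)
  fix l u :: real assume "\<And>b. b \<in> Basis \<Longrightarrow> l \<bullet> b \<le> u \<bullet> b"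
  then have lu: "l \<le> u" by simp
  let ?k = "inv h"
  have k: "?k l \<le> ?k u" using vimage_Icc_homeomorphism(3)[OF h] lu by (simp add: strict_mono_less_eq)
  have "emeasure (distr (dens w) borel h) (box l u) = emeasure (dens w) {?k l<..<?k u}"
    by (subst emeasure_distr) (auto simp: box_real vimage_Icc_homeomorphism(2)[OF h] dens_def)
  also have "\<dots> = emeasure (dens w) {?k l..?k u}"
  proof (rule emeasure_eq_AE)
    have "AE x in lborel. x \<noteq> ?k l \<and> x \<noteq> ?k u" by (intro AE_conjI AE_lborel_singleton)
    then show "AE x in dens w. (x \<in> {?k l<..<?k u}) = (x \<in> {?k l..?k u})"
      by (intro AE_dens wm) (auto elim: eventually_mono)
  qed auto
  also have "\<dots> = ennreal (u - l)"
    using hw[OF k] vimage_Icc_homeomorphism(4)[OF h] by (simp add: emeasure_dens_eq_measure[OF w(1) subset_refl])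
  finally show "emeasure (distr (dens w) borel h) (box l u) = ennreal (\<Prod>b\<in>Basis. (u - l) \<bullet> b)" by simp
qed simp

lemma nn_integral_comp_inv:
  fixes h :: "real \<Rightarrow> real"
  assumes h: "strict_mono h" "homeomorphism UNIV UNIV h (inv h)"
    and D: "A_inf_density h w"
    and p: "p \<in> borel_measurable borel" and E: "E \<in> sets borel"
  shows "(\<integral>\<^sup>+y\<in>E. p (inv h y) \<partial>lborel) = (\<integral>\<^sup>+x\<in>h -` E. p x \<partial>dens w)"
proof -
  have hm [measurable]: "h \<in> borel_measurable borel"
    using homeomorphism_cont1[OF h(2)] by (rule borel_measurable_continuous_onI)
  have km [measurable]: "inv h \<in> borel_measurable borel"
    using homeomorphism_cont2[OF h(2)] by (rule borel_measurable_continuous_onI)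
  note p [measurable] E [measurable]
  have "(\<integral>\<^sup>+y\<in>E. p (inv h y) \<partial>lborel) = (\<integral>\<^sup>+y\<in>E. p (inv h y) \<partial>distr (dens w) borel h)"
    by (simp only: distr_dens_homeomorphism[OF h D])
  also have "\<dots> = (\<integral>\<^sup>+x. p (inv h (h x)) * indicator E (h x) \<partial>dens w)"
    by (rule nn_integral_distr) (auto simp: dens_def)
  also have "\<dots> = (\<integral>\<^sup>+x\<in>h -` E. p x \<partial>dens w)"
    by (intro nn_integral_cong) (simp add: vimage_Icc_homeomorphism(5)[OF h] indicator_def)
  finally show ?thesis .
qed

text \<open>The factor w from the change of variables cancels the denominator. Three choices of p
  matter: p = 1 gives v, p = w gives Lebesgue measure, and p = g' gives r.\<close>

lemma dens_comp_inv:
  fixes h :: "real \<Rightarrow> real"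
  assumes h: "strict_mono h" "homeomorphism UNIV UNIV h (inv h)"
    and D: "A_inf_density h w" and p: "loc_weight p"
  shows "E \<in> sets borel \<Longrightarrow> emeasure (dens (\<lambda>y. p (inv h y) / w (inv h y))) E = emeasure (dens p) (h -` E)"
    and "E \<in> sets borel \<Longrightarrow> measure (dens (\<lambda>y. p (inv h y) / w (inv h y))) E = measure (dens p) (h -` E)"
    and "loc_weight (\<lambda>y. p (inv h y) / w (inv h y))"
proof -
  have w: "loc_weight w" "\<And>x. 0 < w x" and hw: "\<And>a b. a \<le> b \<Longrightarrow> measure (dens w) {a..b} = h b - h a"
    using D by (auto simp: A_inf_density_def)
  have hm [measurable]: "h \<in> borel_measurable borel"
    using homeomorphism_cont1[OF h(2)] by (rule borel_measurable_continuous_onI)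
  have km [measurable]: "inv h \<in> borel_measurable borel"
    using homeomorphism_cont2[OF h(2)] by (rule borel_measurable_continuous_onI)
  have wm [measurable]: "w \<in> borel_measurable borel" using w by (simp add: loc_weight_def)
  have pm [measurable]: "p \<in> borel_measurable borel" using p by (simp add: loc_weight_def)
  have eq: "emeasure (dens (\<lambda>y. p (inv h y) / w (inv h y))) E = emeasure (dens p) (h -` E)" if [measurable]: "E \<in> sets borel" for E
  proof -
    have vE [measurable]: "h -` E \<in> sets borel" using measurable_sets[OF hm that] by simp
    have "emeasure (dens (\<lambda>y. p (inv h y) / w (inv h y))) E = (\<integral>\<^sup>+y\<in>E. ennreal (p (inv h y) / w (inv h y)) \<partial>lborel)"
      unfolding dens_def by (rule emeasure_density) auto
    also have "\<dots> = (\<integral>\<^sup>+x\<in>h -` E. ennreal (p x / w x) \<partial>dens w)"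
      by (rule nn_integral_comp_inv[OF h D]) auto
    also have "\<dots> = (\<integral>\<^sup>+x. ennreal (w x) * (ennreal (p x / w x) * indicator (h -` E) x) \<partial>lborel)"
      unfolding dens_def by (rule nn_integral_density) auto
    also have "\<dots> = (\<integral>\<^sup>+x\<in>h -` E. ennreal (p x) \<partial>lborel)"
    proof (intro nn_integral_cong)
      fix x
      have "ennreal (w x) * ennreal (p x / w x) = ennreal (p x)"
        using w(2)[of x] loc_weight_nonneg[OF p, of x] by (simp flip: ennreal_mult)
      then show "ennreal (w x) * (ennreal (p x / w x) * indicator (h -` E) x) = ennreal (p x) * indicator (h -` E) x"
        by (simp flip: mult.assoc)
    qed
    also have "\<dots> = emeasure (dens p) (h -` E)"
      unfolding dens_def by (rule emeasure_density[symmetric]) auto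
    finally show ?thesis .
  qed
  show "E \<in> sets borel \<Longrightarrow> emeasure (dens (\<lambda>y. p (inv h y) / w (inv h y))) E = emeasure (dens p) (h -` E)" by (rule eq)
  then show "E \<in> sets borel \<Longrightarrow> measure (dens (\<lambda>y. p (inv h y) / w (inv h y))) E = measure (dens p) (h -` E)" by (simp add: measure_def)
  show "loc_weight (\<lambda>y. p (inv h y) / w (inv h y))"
    unfolding loc_weight_def
  proof (intro conjI allI)
    show "0 \<le> p (inv h y) / w (inv h y)" for y using w(2)[of "inv h y"] loc_weight_nonneg[OF p] by simp
    then have nn: "0 \<le> indicator {a..b} y *\<^sub>R (p (inv h y) / w (inv h y))" for a b y :: real by (auto simp: indicator_def)
    fix a b
    have "(\<integral>\<^sup>+y. ennreal (indicator {a..b} y *\<^sub>R (p (inv h y) / w (inv h y))) \<partial>lborel)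
        = (\<integral>\<^sup>+y\<in>{a..b}. ennreal (p (inv h y) / w (inv h y)) \<partial>lborel)"
      by (intro nn_integral_cong) (simp add: indicator_def)
    also have "\<dots> = emeasure (dens (\<lambda>y. p (inv h y) / w (inv h y))) {a..b}"
      unfolding dens_def by (rule emeasure_density[symmetric]) auto
    also have "\<dots> = emeasure (dens p) {inv h a..inv h b}"
      by (simp add: eq vimage_Icc_homeomorphism(1)[OF h])
    also have "\<dots> < \<infinity>" by (subst emeasure_dens_eq_measure[OF p subset_refl]) auto
    finally show "set_integrable lborel {a..b} (\<lambda>y. p (inv h y) / w (inv h y))"
      unfolding set_integrable_def by (intro integrableI_nonneg) (use nn in auto)
  qed measurable
qed

text \<open>If F fills at most half of J, then J - F has at least half of the length of J, which is
  at least half of the w-mass of k(J). The reversed A-infinity inequality gives its image at least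
  the share \<delta> of the length of k(J), and the image of F keeps at most 1 - \<delta>. As v-mass
  is length of the image, this is the one-scale condition for v.\<close>

lemma A_inf_bound_inv:
  fixes h :: "real \<Rightarrow> real"
  assumes h: "strict_mono h" "homeomorphism UNIV UNIV h (inv h)" and D: "A_inf_density h w"
  shows "\<exists>C>0. \<exists>\<beta>>0. A_inf_bound (\<lambda>y. 1 / w (inv h y)) C \<beta>"
proof -
  have w: "loc_weight w" "\<And>x. 0 < w x" and hw: "\<And>a b. a \<le> b \<Longrightarrow> measure (dens w) {a..b} = h b - h a"
    using D by (auto simp: A_inf_density_def)
  obtain C \<alpha> where C: "0 < C" "0 < \<alpha>" and A: "A_inf_bound w C \<alpha>" using D by (auto simp: A_inf_density_def)
  let ?k = "inv h" let ?v = "\<lambda>y. 1 / w (inv h y)"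
  have hm [measurable]: "h \<in> borel_measurable borel"
    using homeomorphism_cont1[OF h(2)] by (rule borel_measurable_continuous_onI)
  have vE: "h -` E \<in> sets borel" if "E \<in> sets borel" for E using measurable_sets[OF hm that] by simp
  have v: "measure (dens ?v) E = measure lborel (h -` E)" if "E \<in> sets borel" for E
    using dens_comp_inv(2)[OF h D loc_weight_1 that] by (simp add: dens_1)
  have "w x / w x = 1" for x using w(2)[of x] by simp
  then have ww: "measure lborel E = measure (dens w) (h -` E)" if "E \<in> sets borel" for E
    using dens_comp_inv(2)[OF h D w(1) that] by (simp add: dens_1)
  \<comment> \<open>The share of length forced by carrying half of the w-mass.\<close>
  define \<delta> where "\<delta> = (1 / 2 / C) powr (1 / \<alpha>)"
  have \<delta>: "0 < \<delta>" using C by (simp add: \<delta>_def)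
  \<comment> \<open>The maximum with 1/2 keeps \<theta> positive without an upper bound on
    \<delta>.\<close>
  define \<theta> where "\<theta> = max (1 / 2) (1 - \<delta>)"
  have \<theta>: "0 < \<theta>" "\<theta> < 1" "1 - \<delta> \<le> \<theta>" using \<delta> by (auto simp: \<theta>_def)
  have "A_inf_bound ?v (1 / \<theta>) (log 4 (1 / \<theta>))"
  proof (rule A_inf_bound_if_half[OF dens_comp_inv(3)[OF h D loc_weight_1] \<theta>(1,2)])
    fix c d :: real and F :: "real set"
    assume cd: "c < d" and F: "F \<in> sets borel" "F \<subseteq> {c..d}" and small: "measure lborel F \<le> (d - c) / 2"
    have kcd: "?k c < ?k d" using vimage_Icc_homeomorphism(3)[OF h] cd by (simp add: strict_mono_less)
    have Fi: "F \<inter> {c..d} = F" using F by auto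
    have vF: "h -` F \<inter> {?k c..?k d} = h -` F"
      using F vimage_mono[of F "{c..d}" h] by (simp add: vimage_Icc_homeomorphism(1)[OF h] Int_absorb2)
    have P: "h -` ({c..d} - F) = {?k c..?k d} - h -` F"
      by (simp add: vimage_Diff vimage_Icc_homeomorphism(1)[OF h])
    have wk: "measure (dens w) {?k c..?k d} = d - c"
      using hw[OF less_imp_le[OF kcd]] vimage_Icc_homeomorphism(4)[OF h] by simp
    have "1 / 2 * measure (dens w) {?k c..?k d} \<le> measure lborel ({c..d} - F)"
      using measure_Icc_minus[OF loc_weight_1 F(1), of c d] small cd by (simp add: dens_1 Fi wk)
    also have "\<dots> = measure (dens w) ({?k c..?k d} - h -` F)"
      using ww[of "{c..d} - F"] F by (simp add: P)
    finally have "\<delta> * (?k d - ?k c) \<le> measure lborel ({?k c..?k d} - h -` F)"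
      unfolding \<delta>_def using vE[OF F(1)] wk cd
      by (intro A_inf_bound_measure_ge[OF A C kcd]) auto
    moreover have "measure lborel ({?k c..?k d} - h -` F) + measure lborel (h -` F) = ?k d - ?k c"
      using measure_Icc_minus[OF loc_weight_1 vE[OF F(1)], of "?k c" "?k d"] kcd by (simp add: dens_1 vF)
    ultimately have "measure lborel (h -` F) \<le> (1 - \<delta>) * (?k d - ?k c)" by (simp add: algebra_simps)
    also have "\<dots> \<le> \<theta> * (?k d - ?k c)" using \<theta> kcd by (intro mult_right_mono) auto
    finally show "measure (dens ?v) F \<le> \<theta> * measure (dens ?v) {c..d}"
      using kcd by (simp add: v F vimage_Icc_homeomorphism(1)[OF h])
  qed
  moreover have "0 < log 4 (1 / \<theta>)" "0 < 1 / \<theta>" using \<theta> by auto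
  ultimately show ?thesis by blast
qed

text \<open>The bound for v limits the share of k(F) in k(J), and the bound for p turns that share
  into a share of mass. Substituting B t^\<beta> into C s^\<alpha> gives the constant C B^\<alpha>
  and the exponent \<beta>\<alpha>.\<close>

lemma A_inf_density_comp_inv:
  fixes g h :: "real \<Rightarrow> real"
  assumes h: "strict_mono h" "homeomorphism UNIV UNIV h (inv h)" and Dh: "A_inf_density h w"
    and Dg: "A_inf_density g p"
  shows "A_inf_density (g \<circ> inv h) (\<lambda>y. p (inv h y) / w (inv h y))"
proof -
  have w: "loc_weight w" "\<And>x. 0 < w x" and hw: "\<And>a b. a \<le> b \<Longrightarrow> measure (dens w) {a..b} = h b - h a"
    using Dh by (auto simp: A_inf_density_def)
  have p: "loc_weight p" "\<And>x. 0 < p x" and gp: "\<And>a b. a \<le> b \<Longrightarrow> measure (dens p) {a..b} = g b - g a"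
    using Dg by (auto simp: A_inf_density_def)
  let ?k = "inv h" let ?r = "\<lambda>y. p (inv h y) / w (inv h y)" let ?v = "\<lambda>y. 1 / w (inv h y)"
  obtain C \<alpha> where C: "0 < C" "0 < \<alpha>" and A: "A_inf_bound p C \<alpha>" using Dg by (auto simp: A_inf_density_def)
  obtain B \<beta> where B: "0 < B" "0 < \<beta>" and Av: "A_inf_bound ?v B \<beta>" using A_inf_bound_inv[OF h Dh] by blast
  have hm [measurable]: "h \<in> borel_measurable borel"
    using homeomorphism_cont1[OF h(2)] by (rule borel_measurable_continuous_onI)
  have vE: "h -` E \<in> sets borel" if "E \<in> sets borel" for E using measurable_sets[OF hm that] by simp
  have v: "measure (dens ?v) E = measure lborel (h -` E)" if "E \<in> sets borel" for E
    using dens_comp_inv(2)[OF h Dh loc_weight_1 that] by (simp add: dens_1)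
  note r = dens_comp_inv(2)[OF h Dh p(1)] and k = vimage_Icc_homeomorphism[OF h]
  have "A_inf_bound ?r (C * B powr \<alpha>) (\<beta> * \<alpha>)"
    unfolding A_inf_bound_def
  proof (intro allI impI)
    fix c d :: real and F :: "real set" assume cd: "c < d" and F: "F \<in> sets borel" "F \<subseteq> {c..d}"
    have kcd: "?k c < ?k d" using k(3) cd by (simp add: strict_mono_less)
    have vF: "h -` F \<subseteq> {?k c..?k d}" using F vimage_mono[of F "{c..d}" h] by (simp add: k(1))
    define t where "t = measure lborel F / (d - c)"
    have t: "0 \<le> t" using cd by (simp add: t_def)
    have "measure lborel (h -` F) \<le> B * t powr \<beta> * (?k d - ?k c)"
      using A_inf_boundD[OF Av cd F] kcd by (simp add: v F k(1) t_def)
    then have "measure lborel (h -` F) / (?k d - ?k c) \<le> B * t powr \<beta>" using kcd by (simp add: pos_divide_le_eq)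
    then have "(measure lborel (h -` F) / (?k d - ?k c)) powr \<alpha> \<le> (B * t powr \<beta>) powr \<alpha>"
      using C kcd by (intro powr_mono2) auto
    also have "\<dots> = B powr \<alpha> * t powr (\<beta> * \<alpha>)" using B t by (simp add: powr_mult powr_powr)
    finally have le: "(measure lborel (h -` F) / (?k d - ?k c)) powr \<alpha> \<le> B powr \<alpha> * t powr (\<beta> * \<alpha>)" .
    have "measure (dens ?r) F = measure (dens p) (h -` F)" by (rule r[OF F(1)])
    also have "\<dots> \<le> C * (measure lborel (h -` F) / (?k d - ?k c)) powr \<alpha> * measure (dens p) {?k c..?k d}"
      by (rule A_inf_boundD[OF A kcd vE[OF F(1)] vF])
    also have "\<dots> \<le> C * (B powr \<alpha> * t powr (\<beta> * \<alpha>)) * measure (dens p) {?k c..?k d}"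
      using C le by (intro mult_right_mono mult_left_mono) auto
    also have "measure (dens p) {?k c..?k d} = measure (dens ?r) {c..d}" by (simp add: r k(1))
    finally show "measure (dens ?r) F \<le> C * B powr \<alpha> * (measure lborel F / (d - c)) powr (\<beta> * \<alpha>) * measure (dens ?r) {c..d}"
      by (simp add: t_def mult.assoc)
  qed
  moreover have "0 < C * B powr \<alpha>" "0 < \<beta> * \<alpha>" using B C by auto
  moreover have "loc_weight ?r" by (rule dens_comp_inv(3)[OF h Dh p(1)])
  moreover have "measure (dens ?r) {a..b} = (g \<circ> ?k) b - (g \<circ> ?k) a" if "a \<le> b" for a b
    using gp[of "?k a" "?k b"] that k(3) by (simp add: r k(1) strict_mono_less_eq)
  ultimately show ?thesis using w(2) p(2) unfolding A_inf_density_def by (auto intro!: divide_pos_pos)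
qed

section \<open>VMO under differences and under composition with the inverse homeomorphism\<close>

lemma VMO_mean_oscillation_bounded:
  assumes "u \<in> VMO"
  obtains K where "\<And>a b. a < b \<Longrightarrow> mean_oscillation u {a..b} \<le> K"
proof -
  have "bdd_above {mean_oscillation u {a..b} | a b. a < b}" using assms by (simp add: VMO_def BMO_def)
  then obtain K where "\<forall>x\<in>{mean_oscillation u {a..b} | a b. a < b}. x \<le> K" unfolding bdd_above_def by blast
  then have "mean_oscillation u {a..b} \<le> K" if "a < b" for a b using that by blast
  then show ?thesis by (rule that)
qed

lemma VMO_diff:
  assumes "u \<in> VMO" "v \<in> VMO"
  shows "(\<lambda>x. u x - v x) \<in> VMO"
proof -
  have u: "u \<in> borel_measurable lebesgue" "\<And>a b. set_integrable lebesgue {a..b} u"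
    and v: "v \<in> borel_measurable lebesgue" "\<And>a b. set_integrable lebesgue {a..b} v"
    using assms by (auto simp: VMO_def BMO_def locally_integrable_def)
  have le: "mean_oscillation (\<lambda>x. u x - v x) {a..b} \<le> mean_oscillation u {a..b} + mean_oscillation v {a..b}" if "a < b" for a b
    by (rule mean_oscillation_diff_le[OF that u(2) v(2)])
  obtain K where K: "\<And>a b. a < b \<Longrightarrow> mean_oscillation u {a..b} \<le> K"
    by (rule VMO_mean_oscillation_bounded[OF assms(1)]) (rule that)
  obtain L where L: "\<And>a b. a < b \<Longrightarrow> mean_oscillation v {a..b} \<le> L"
    by (rule VMO_mean_oscillation_bounded[OF assms(2)]) (rule that)
  have "mean_oscillation (\<lambda>x. u x - v x) {a..b} \<le> K + L" if "a < b" for a b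
    using le[OF that] K[OF that] L[OF that] by simp
  then have "bdd_above {mean_oscillation (\<lambda>x. u x - v x) {a..b} |a b. a < b}" unfolding bdd_above_def by blast
  moreover have "locally_integrable (\<lambda>x. u x - v x)"
    using u v by (auto simp: locally_integrable_def intro!: set_integral_diff(1))
  moreover have "\<exists>\<delta>>0. \<forall>a b. a < b \<and> b - a < \<delta> \<longrightarrow> mean_oscillation (\<lambda>x. u x - v x) {a..b} < \<epsilon>" if "\<epsilon> > 0" for \<epsilon>
  proof -
    have "\<epsilon> / 2 > 0" using that by simp
    then obtain \<delta> \<delta>' where d: "\<delta> > 0" "\<And>a b. a < b \<and> b - a < \<delta> \<Longrightarrow> mean_oscillation u {a..b} < \<epsilon> / 2"
      and d': "\<delta>' > 0" "\<And>a b. a < b \<and> b - a < \<delta>' \<Longrightarrow> mean_oscillation v {a..b} < \<epsilon> / 2"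
      using assms unfolding VMO_def by blast
    show ?thesis
    proof (intro exI[of _ "min \<delta> \<delta>'"] conjI allI impI)
      fix a b assume "a < b \<and> b - a < min \<delta> \<delta>'"
      then show "mean_oscillation (\<lambda>x. u x - v x) {a..b} < \<epsilon>"
        using le[of a b] d(2)[of a b] d'(2)[of a b] by simp
    qed (use d d' in auto)
  qed
  ultimately show ?thesis by (simp add: VMO_def BMO_def)
qed

text \<open>The factor K is the same for all N and all intervals: a global N then gives BMO, and a
  small N on short intervals gives the vanishing condition. Integrability is part of the conclusion,
  since finiteness of the weighted integral is what proves it.\<close>

lemma mean_oscillation_comp_inv_le:
  fixes h u :: "real \<Rightarrow> real"
  assumes h: "strict_mono h" "homeomorphism UNIV UNIV h (inv h)" and D: "A_inf_density h w"
    and u: "u \<in> borel_measurable borel" "\<And>a b. set_integrable lebesgue {a..b} u"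
  obtains K where "K > 0"
    "\<And>N c d. N > 0 \<Longrightarrow> c < d \<Longrightarrow>
      (\<And>a b. inv h c \<le> a \<Longrightarrow> a < b \<Longrightarrow> b \<le> inv h d \<Longrightarrow> mean_oscillation u {a..b} \<le> N) \<Longrightarrow>
      set_integrable lebesgue {c..d} (\<lambda>y. u (inv h y)) \<and> mean_oscillation (\<lambda>y. u (inv h y)) {c..d} \<le> K * N"
proof -
  have w: "loc_weight w" "\<And>x. 0 < w x" and hw: "\<And>a b. a \<le> b \<Longrightarrow> measure (dens w) {a..b} = h b - h a"
    using D by (auto simp: A_inf_density_def)
  obtain C \<alpha> where C: "0 < C" "0 < \<alpha>" and A: "A_inf_bound w C \<alpha>" using D by (auto simp: A_inf_density_def)
  \<comment> \<open>Large enough that C \<kappa>^(-\<alpha>) \<le> 1/2, so that sets of relative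
    length 1/\<kappa> carry at most half of the w-mass.\<close>
  define \<kappa> where "\<kappa> = max 1 ((2 * C) powr (1 / \<alpha>))"
  have \<kappa>: "1 \<le> \<kappa>" by (simp add: \<kappa>_def)
  have "2 * C = ((2 * C) powr (1 / \<alpha>)) powr \<alpha>" using C by (simp add: powr_powr)
  also have "\<dots> \<le> \<kappa> powr \<alpha>" using C by (intro powr_mono2) (auto simp: \<kappa>_def)
  finally have "C * (1 / \<kappa>) powr \<alpha> \<le> 1 / 2" using C \<kappa> by (simp add: powr_divide field_simps)
  note \<kappa>' = C \<kappa> this
  have km [measurable]: "inv h \<in> borel_measurable borel"
    using homeomorphism_cont2[OF h(2)] by (rule borel_measurable_continuous_onI)
  note u(1) [measurable]
  note k = vimage_Icc_homeomorphism[OF h]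
  show ?thesis
  \<comment> \<open>The factor 8\<kappa> of the weighted estimate, doubled for passing from the
    centre m to the mean of the composed function.\<close>
  proof (rule that[of "16 * \<kappa>"])
    show "16 * \<kappa> > 0" using \<kappa> by simp
    fix N c d :: real
    assume N: "N > 0" and cd: "c < d"
      and osc: "\<And>a b. inv h c \<le> a \<Longrightarrow> a < b \<Longrightarrow> b \<le> inv h d \<Longrightarrow> mean_oscillation u {a..b} \<le> N"
    have kcd: "inv h c < inv h d" using k(3) cd by (simp add: strict_mono_less)
    let ?I = "{inv h c..inv h d}"
    \<comment> \<open>The unweighted mean of u over k([c,d]), in general not the mean of the
      composed function over [c,d].\<close>
    define m where "m = mean u ?I"
    define U where "U y = u (inv h y)" for y
    have Um [measurable]: "U \<in> borel_measurable borel" unfolding U_def by measurable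
    have "(\<integral>\<^sup>+y\<in>{c..d}. ennreal \<bar>U y - m\<bar> \<partial>lborel) = (\<integral>\<^sup>+x\<in>h -` {c..d}. ennreal \<bar>u x - m\<bar> \<partial>dens w)"
      unfolding U_def by (rule nn_integral_comp_inv[OF h D, where p="\<lambda>x. ennreal \<bar>u x - m\<bar>"]) auto
    also have "\<dots> \<le> ennreal (8 * \<kappa> * N) * emeasure (dens w) ?I"
      unfolding k(1) m_def by (rule nn_integral_oscillation_le[OF w(1) A \<kappa>' u N kcd osc])
    also have "\<dots> = ennreal (8 * \<kappa> * N) * ennreal (d - c)"
      using hw[OF less_imp_le[OF kcd]] k(4) by (simp add: emeasure_dens_eq_measure[OF w(1) subset_refl])
    also have "\<dots> = ennreal (8 * \<kappa> * N * (d - c))"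
      by (rule ennreal_mult[symmetric]) (use \<kappa> N cd in auto)
    finally have le: "(\<integral>\<^sup>+y\<in>{c..d}. ennreal \<bar>U y - m\<bar> \<partial>lborel) \<le> ennreal (8 * \<kappa> * N * (d - c))" .
    have ieq: "(\<integral>\<^sup>+y. ennreal (indicator {c..d} y *\<^sub>R \<bar>U y - m\<bar>) \<partial>lborel) = (\<integral>\<^sup>+y\<in>{c..d}. ennreal \<bar>U y - m\<bar> \<partial>lborel)"
      by (intro nn_integral_cong) (simp add: indicator_def)
    have i1: "set_integrable lborel {c..d} (\<lambda>y. \<bar>U y - m\<bar>)"
      unfolding set_integrable_def
    proof (rule integrableI_nonneg)
      show "(\<integral>\<^sup>+y. ennreal (indicator {c..d} y *\<^sub>R \<bar>U y - m\<bar>) \<partial>lborel) < \<infinity>"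
        unfolding ieq by (rule le_less_trans[OF le]) simp
    qed auto
    have "set_integrable lborel {c..d} (\<lambda>y. U y - m)"
      by (rule set_integrable_bound[OF i1]) (auto simp: set_borel_measurable_def)
    then have i2: "set_integrable lebesgue {c..d} (\<lambda>y. U y - m)"
      by (subst set_integrable_lebesgue_iff) auto
    have i3: "set_integrable lebesgue {c..d} U"
      using set_integral_add(1)[OF i2 set_integrable_const_Icc[of c d m]] by simp
    have "ennreal (LINT y:{c..d}|lborel. \<bar>U y - m\<bar>) = (\<integral>\<^sup>+y. ennreal (indicator {c..d} y *\<^sub>R \<bar>U y - m\<bar>) \<partial>lborel)"
      unfolding set_lebesgue_integral_def using i1
      by (intro nn_integral_eq_integral[symmetric]) (auto simp: set_integrable_def)
    also have "\<dots> \<le> ennreal (8 * \<kappa> * N * (d - c))" using le by (simp only: ieq)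
    finally have "(LINT y:{c..d}|lborel. \<bar>U y - m\<bar>) \<le> 8 * \<kappa> * N * (d - c)"
      using \<kappa> N cd by (subst (asm) ennreal_le_iff) auto
    then have "mean (\<lambda>y. \<bar>U y - m\<bar>) {c..d} \<le> 8 * \<kappa> * N"
      using cd by (simp add: mean_def set_integral_lebesgue pos_divide_le_eq)
    then have "mean_oscillation U {c..d} \<le> 16 * \<kappa> * N"
      using mean_oscillation_le[OF cd i3, of m] by simp
    then show "set_integrable lebesgue {c..d} (\<lambda>y. u (inv h y)) \<and> mean_oscillation (\<lambda>y. u (inv h y)) {c..d} \<le> 16 * \<kappa> * N"
      using i3 by (simp add: U_def[abs_def])
  qed
qed

lemma VMO_comp_inv:
  fixes h u :: "real \<Rightarrow> real"
  assumes h: "strict_mono h" "homeomorphism UNIV UNIV h (inv h)" and D: "A_inf_density h w"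
    and uc: "uniformly_continuous_on UNIV (inv h)"
    and u: "u \<in> borel_measurable borel" "u \<in> VMO"
  shows "(\<lambda>y. u (inv h y)) \<in> VMO"
proof -
  have ui: "\<And>a b. set_integrable lebesgue {a..b} u" using u by (auto simp: VMO_def BMO_def locally_integrable_def)
  obtain K where K: "K > 0" and Kb: "\<And>N c d. N > 0 \<Longrightarrow> c < d \<Longrightarrow>
      (\<And>a b. inv h c \<le> a \<Longrightarrow> a < b \<Longrightarrow> b \<le> inv h d \<Longrightarrow> mean_oscillation u {a..b} \<le> N) \<Longrightarrow>
      set_integrable lebesgue {c..d} (\<lambda>y. u (inv h y)) \<and> mean_oscillation (\<lambda>y. u (inv h y)) {c..d} \<le> K * N"
    using mean_oscillation_comp_inv_le[OF h D u(1) ui] by blast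
  have mono: "strict_mono (inv h)" by (rule vimage_Icc_homeomorphism(3)[OF h])
  have km [measurable]: "inv h \<in> borel_measurable borel"
    using homeomorphism_cont2[OF h(2)] by (rule borel_measurable_continuous_onI)
  note u(1) [measurable]
  obtain B where B: "\<And>a b. a < b \<Longrightarrow> mean_oscillation u {a..b} \<le> B"
    by (rule VMO_mean_oscillation_bounded[OF u(2)]) (rule that)
  \<comment> \<open>The oscillation estimate asks for a positive bound, and B may be 0.\<close>
  have "max 1 B > 0" by simp
  then have glob: "set_integrable lebesgue {c..d} (\<lambda>y. u (inv h y)) \<and> mean_oscillation (\<lambda>y. u (inv h y)) {c..d} \<le> K * max 1 B"
    if "c < d" for c d
    using that B by (intro Kb) (auto intro: order_trans[OF _ max.cobounded2])
  have "set_integrable lebesgue {c..d} (\<lambda>y. u (inv h y))" for c d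
  \<comment> \<open>The estimate covers nondegenerate intervals only, so [c,d] is enlarged to one of
    length at least 1.\<close>
  proof (rule set_integrable_subset[of lebesgue "{c..max d (c + 1)}"])
    have "c < max d (c + 1)" by linarith
    then show "set_integrable lebesgue {c..max d (c + 1)} (\<lambda>y. u (inv h y))" by (rule glob[THEN conjunct1])
  qed auto
  moreover have "(\<lambda>y. u (inv h y)) \<in> borel_measurable lebesgue"
    by (rule borel_measurable_lebesgueI) measurable
  moreover have "bdd_above {mean_oscillation (\<lambda>y. u (inv h y)) {a..b} |a b. a < b}"
    using glob unfolding bdd_above_def by blast
  moreover have "\<exists>\<delta>>0. \<forall>a b. a < b \<and> b - a < \<delta> \<longrightarrow> mean_oscillation (\<lambda>y. u (inv h y)) {a..b} < \<epsilon>" if \<epsilon>: "\<epsilon> > 0" for \<epsilon>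
  proof -
    \<comment> \<open>Makes K N = \<epsilon>/2, which leaves room for the strict inequality.\<close>
    define N where "N = \<epsilon> / (2 * K)"
    have N: "N > 0" using \<epsilon> K by (simp add: N_def)
    then obtain \<delta> where d: "\<delta> > 0" "\<And>a b. a < b \<and> b - a < \<delta> \<Longrightarrow> mean_oscillation u {a..b} < N"
      using u(2) unfolding VMO_def by blast
    obtain \<delta>' where d': "\<delta>' > 0" "\<And>x y. dist x y < \<delta>' \<Longrightarrow> dist (inv h x) (inv h y) < \<delta>"
      using uc d(1) unfolding uniformly_continuous_on_def by (metis UNIV_I)
    show ?thesis
    proof (intro exI[of _ \<delta>'] conjI allI impI)
      fix c d assume cd: "c < d \<and> d - c < \<delta>'"
      then have "inv h d - inv h c < \<delta>"
        using d'(2)[of d c] strict_monoD[OF mono, of c d] by (simp add: dist_real_def)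
      then have "mean_oscillation u {a..b} \<le> N" if "inv h c \<le> a" "a < b" "b \<le> inv h d" for a b
        using d(2)[of a b] that by simp
      then have "mean_oscillation (\<lambda>y. u (inv h y)) {c..d} \<le> K * N" using Kb[OF N] cd by blast
      also have "\<dots> < \<epsilon>" using K \<epsilon> by (simp add: N_def)
      finally show "mean_oscillation (\<lambda>y. u (inv h y)) {c..d} < \<epsilon>" .
    qed (use d' in simp)
  qed
  ultimately show ?thesis by (simp add: VMO_def BMO_def locally_integrable_def)
qed

theorem theorem1:
  fixes g h :: "real \<Rightarrow> real"
  assumes "g \<in> SS" and "h \<in> SS"
    and "uniformly_continuous_on UNIV (inv h)"
  shows "g \<circ> inv h \<in> SS"
proof -
  have h: "strict_mono h" "homeomorphism UNIV UNIV h (inv h)"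
    and g: "strict_mono g" "homeomorphism UNIV UNIV g (inv g)"
    using assms by (auto simp: SS_def)
  obtain w where w: "A_inf_density h w" "(\<lambda>x. ln (w x)) \<in> VMO" using SS_density[OF assms(2)] by blast
  obtain p where p: "A_inf_density g p" "(\<lambda>x. ln (p x)) \<in> VMO" using SS_density[OF assms(1)] by blast
  have [measurable]: "w \<in> borel_measurable borel" "p \<in> borel_measurable borel"
    using w p by (auto simp: A_inf_density_def loc_weight_def)
  have pos: "0 < w x" "0 < p x" for x using w p by (auto simp: A_inf_density_def)
  let ?u = "\<lambda>x. ln (p x) - ln (w x)"
  have "?u \<in> VMO" by (rule VMO_diff[OF p(2) w(2)])
  then have "(\<lambda>y. ?u (inv h y)) \<in> VMO" by (intro VMO_comp_inv[OF h w(1) assms(3)]) auto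
  \<comment> \<open>Valid at every x because both densities are positive everywhere.\<close>
  moreover have "ln (p x / w x) = ln (p x) - ln (w x)" for x using pos[of x] by (simp add: ln_div)
  ultimately have V: "(\<lambda>y. ln (p (inv h y) / w (inv h y))) \<in> VMO" by simp
  have "homeomorphism UNIV UNIV (g \<circ> inv h) (h \<circ> inv g)"
    by (rule homeomorphism_compose[OF homeomorphism_symD[OF h(2)] g(2)])
  moreover have "inv (g \<circ> inv h) = h \<circ> inv g"
    by (rule inv_equality) (simp_all add: homeomorphism_apply1[OF g(2)] homeomorphism_apply2[OF g(2)] homeomorphism_apply1[OF h(2)] homeomorphism_apply2[OF h(2)])
  ultimately have hom: "homeomorphism UNIV UNIV (g \<circ> inv h) (inv (g \<circ> inv h))" by simp
  have "strict_mono (g \<circ> inv h)"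
    using g(1) vimage_Icc_homeomorphism(3)[OF h] by (simp add: strict_mono_def)
  then show ?thesis
    by (rule SS_if_density[OF _ hom A_inf_density_comp_inv[OF h w(1) p(1)] V])
qed

end
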